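(* There is a bijection between formal $N=1$ superanalytic (not necessarily superconformal) functions $$f(x,\varphi)=(\tilde x,\tilde\varphi)\in\big(x\textstyle\bigwedge_*^0[[x]]\oplus\varphi x\bigwedge_*^1[[x]],\ x\bigwedge_*^1[[x]]\oplus\varphi\bigwedge_*^0[[x]]\big)$$ (that is, vanishing at $(x,\varphi)=(0,0)$ and with even part vanishing at $x=0$) which are invertible in a neighborhood of zero, and expressions of the form $$\exp\Big(-\sum_{n\in\mathbb{Z}_+}\big(A^{(1)}_nL_n(x,\varphi)+A^{(2)}_nJ_n(x,\varphi)+M^{(1)}_{n-\frac12}G^{(1)}_{n-\frac12}(x,\varphi)+M^{(2)}_{n-\frac12}G^{(2)}_{n-\frac12}(x,\varphi)\big)\Big)\cdot(a_0^{(1)})^{-2L_0(x,\varphi)}\cdot(a_0^{(2)})^{-J_0(x,\varphi)}\cdot(x,\varphi)$$ for $(a_0^{(1)},a_0^{(2)})\in((\bigwedge_*^0)^\times)^2/\langle(-1,-1)\rangle$, and $A^{(j)}_n\in\bigwedge_*^0$, $M^{(j)}_{n-1/2}\in\bigwedge_*^1$ for $n\in\mathbb{Z}_+$, $j=1,2$, where $$L_n(x,\varphi)=-\Big(x^{n+1}\frac{\partial}{\partial x}+\frac{n+1}{2}x^n\varphi\frac{\partial}{\partial\varphi}\Big),\quad J_n(x,\varphi)=x^n\varphi\frac{\partial}{\partial\varphi},\quad G^{(j)}_{n-\frac12}(x,\varphi)=(-i)^{j+1}x^n\Big(\frac{\partial}{\partial\varphi}+(-1)^j\varphi\frac{\partial}{\partial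 x}\Big)$$ are superderivations in $\mathrm{Der}(\bigwedge_*[[x,x^{-1}]][\varphi])$, for $n\in\mathbb{Z}$, which give a representation of the $N=2$ Neveu-Schwarz algebra with central charge zero in the nonhomogeneous basis. Similarly, there is a bijection between formal $N=1$ superanalytic functions $$f(x,\varphi)=(\tilde x,\tilde\varphi)\in\big(x^{-1}\textstyle\bigwedge_*^0[[x^{-1}]]\oplus\varphi x^{-2}\bigwedge_*^1[[x^{-1}]],\ x^{-1}\bigwedge_*^1[[x^{-1}]]\oplus\varphi x^{-1}\bigwedge_*^0[[x^{-1}]]\big)$$ (that is, vanishing at $(\infty,0)$ and such that $x\frac{\partial}{\partial\varphi}\tilde x$ also vanishes as $x\to\infty$) which are invertible in a neighborhood of $(\infty,0)$, and expressions of the form $$\exp\Big(\sum_{n\in\mathbb{Z}_+}\big(A^{(1)}_nL_{-n}(x,\varphi)-A^{(2)}_nJ_{-n}(x,\varphi)+iM^{(1)}_{n-\frac12}G^{(1)}_{-n+\frac12}(x,\varphi)+iM^{(2)}_{n-\frac12}G^{(2)}_{-n+\frac12}(x,\varphi)\big)\Big)\cdot(a_0^{(1)})^{2L_0(x,\varphi)}\cdot(a_0^{(2)})^{-J_0(x,\varphi)}\cdot\Big(\frac1x,\frac{i\varphi}{x}\Big)$$ with parameters $a_0^{(j)},A^{(j)}_n,M^{(j)}_{n-1/2}$ ranging over the same sets.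
   Context: Grassmann algebra: $\bigwedge_L$ ($L\in\mathbb{N}$) is the exterior algebra over $\mathbb{C}$ on $L$ generators, $\bigwedge_L\subset\bigwedge_{L+1}$, $\bigwedge_\infty=\bigcup_L\bigwedge_L$; $\bigwedge_*$ is one of these, with even and odd parts $\bigwedge_*^0,\bigwedge_*^1$; $(\bigwedge_*^0)^\times$ is the group of invertible even elements. $\mathbb{Z}_+$ denotes the positive integers. $x$ is an even formal variable; $\varphi$ is an odd formal variable (commuting with $x$ and $\bigwedge_*^0$, anticommuting with $\bigwedge_*^1$, $\varphi^2=0$). A formal $N=1$ superanalytic function is a pair $(\tilde x,\tilde\varphi)$ with $\tilde x\in(\bigwedge_*[[x,x^{-1}]][\varphi])^0$ and $\tilde\varphi\in(\bigwedge_*[[x,x^{-1}]][\varphi])^1$. Invertibility in a neighborhood of zero means that the coefficient of $x$ in $\tilde x$ and the coefficient of $\varphi$ in $\tilde\varphi$ are invertible; invertibility in a neighborhood of $(\infty,0)$ means that $f(1/x,-i\varphi/x)$ is invertible in a neighborhood of zero. Operators act on each component of a pair; for $a\in(\bigwedge_*^0)^\times$, $a^{-2L_0(x,\varphi)}$ is the automorphism $x\mapsto a^2x,\ \varphi\mapsto a\varphi$, $a^{2L_0(x,\varphi)}$ is its inverse, and $a^{-J_0(x,\varphi)}$ is the automorphism $x\mapsto x,\ \varphi\mapsto a^{-1}\varphi$. The $N=2$ Neveu-Schwarz algebra in the nonhomogeneous basis is the Lie superalgebra with basis: central $d$, even $L_n,J_n$, odd $G^{(1)}_{n+1/2},G^{(2)}_{n+1/2}$,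 $n\in\mathbb{Z}$, with (super)brackets, for $m,n\in\mathbb{Z}$, $j=1,2$: $[L_m,L_n]=(m-n)L_{m+n}+\frac1{12}(m^3-m)\delta_{m+n,0}d$; $[J_m,J_n]=\frac13m\delta_{m+n,0}d$; $[L_m,J_n]=-nJ_{m+n}$; $[L_m,G^{(j)}_{n+1/2}]=(\frac m2-n-\frac12)G^{(j)}_{m+n+1/2}$; $[J_m,G^{(1)}_{n+1/2}]=-iG^{(2)}_{m+n+1/2}$; $[J_m,G^{(2)}_{n+1/2}]=iG^{(1)}_{m+n+1/2}$; $[G^{(j)}_{m+1/2},G^{(j)}_{n-1/2}]=2L_{m+n}+\frac13(m^2+m)\delta_{m+n,0}d$; $[G^{(1)}_{m+1/2},G^{(2)}_{n-1/2}]=-i(m-n+1)J_{m+n}$. A representation with central charge zero satisfies these with $d=0$. *)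

theory Defs
  imports
    Complex_Main
    "HOL-Library.Extended_Nat"
    "HOL-Library.FuncSet"
    "HOL-Algebra.Coset"
    "HOL-Algebra.Generated_Groups"
begin

section \<open>The Grassmann algebra\<close>

text \<open>
  An element of the Grassmann algebra on the generators \<open>\<zeta>\<^sub>0, \<zeta>\<^sub>1, \<dots>\<close> is given by its
  complex coefficients with respect to the basis of ordered monomials
  \<open>\<zeta>\<^sub>S = \<zeta>\<^bsub>s1\<^esub> \<cdots> \<zeta>\<^bsub>sk\<^esub>\<close>, where \<open>S = {s1 < \<dots> < sk}\<close> is a finite set of naturals.
  The whole type is \<open>\<Lambda>\<^sub>\<infinity>\<close>.
\<close>

typedef grassmann =
  "{f :: nat set \<Rightarrow> complex. finite {S. f S \<noteq> 0} \<and> (\<forall>S. f S \<noteq> 0 \<longrightarrow> finite S)}"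
  morphisms gcoeff Abs_grassmann
  by (rule exI[of _ "\<lambda>_. 0"]) auto

setup_lifting type_definition_grassmann

text \<open>For disjoint finite \<open>S\<close>, \<open>T\<close>: \<open>\<zeta>\<^sub>S \<zeta>\<^sub>T = ext_sign S T \<cdot> \<zeta>\<^bsub>S \<union> T\<^esub>\<close>; one sign per inversion.\<close>

definition ext_sign :: "nat set \<Rightarrow> nat set \<Rightarrow> complex" where
  "ext_sign S T = (-1) ^ card {(s, t). s \<in> S \<and> t \<in> T \<and> t < s}"

lemma ext_sign_union_left:
  assumes "finite S" "finite T" "finite U" "S \<inter> T = {}"
  shows "ext_sign (S \<union> T) U = ext_sign S U * ext_sign T U"
proof -
  have eq: "{(s, t). s \<in> S \<union> T \<and> t \<in> U \<and> t < s} =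
      {(s, t). s \<in> S \<and> t \<in> U \<and> t < s} \<union> {(s, t). s \<in> T \<and> t \<in> U \<and> t < s}"
    by auto
  have fin: "finite {(s, t). s \<in> X \<and> t \<in> U \<and> t < s}" if "finite X" for X :: "nat set"
    by (rule finite_subset[of _ "X \<times> U"]) (use that assms in auto)
  show ?thesis
    unfolding ext_sign_def eq
    by (subst card_Un_disjoint) (use assms fin in \<open>auto simp: power_add\<close>)
qed

lemma ext_sign_union_right:
  assumes "finite S" "finite T" "finite U" "T \<inter> U = {}"
  shows "ext_sign S (T \<union> U) = ext_sign S T * ext_sign S U"
proof -
  have eq: "{(s, t). s \<in> S \<and> t \<in> T \<union> U \<and> t < s} =
      {(s, t). s \<in> S \<and> t \<in> T \<and> t < s} \<union> {(s, t). s \<in> S \<and> t \<in> U \<and> t < s}"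
    by auto
  have fin: "finite {(s, t). s \<in> S \<and> t \<in> X \<and> t < s}" if "finite X" for X :: "nat set"
    by (rule finite_subset[of _ "S \<times> X"]) (use that assms in auto)
  show ?thesis
    unfolding ext_sign_def eq
    by (subst card_Un_disjoint) (use assms fin in \<open>auto simp: power_add\<close>)
qed

lemma ext_sign_empty [simp]: "ext_sign {} T = 1" "ext_sign S {} = 1"
  by (simp_all add: ext_sign_def)

instantiation grassmann :: ring_1
begin

lift_definition zero_grassmann :: grassmann is "\<lambda>_. 0" by simp

lift_definition one_grassmann :: grassmann is "\<lambda>S. if S = {} then 1 else 0" by simp

lift_definition plus_grassmann :: "grassmann \<Rightarrow> grassmann \<Rightarrow> grassmann" is "\<lambda>f g S. f S + g S"
proof -
  fix f g :: "nat set \<Rightarrow> complex"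
  assume "finite {S. f S \<noteq> 0} \<and> (\<forall>S. f S \<noteq> 0 \<longrightarrow> finite S)"
    and "finite {S. g S \<noteq> 0} \<and> (\<forall>S. g S \<noteq> 0 \<longrightarrow> finite S)"
  moreover have "{S. f S + g S \<noteq> 0} \<subseteq> {S. f S \<noteq> 0} \<union> {S. g S \<noteq> 0}"
    by auto
  ultimately show "finite {S. f S + g S \<noteq> 0} \<and> (\<forall>S. f S + g S \<noteq> 0 \<longrightarrow> finite S)"
    using finite_subset[of "{S. f S + g S \<noteq> 0}"] by fastforce
qed

lift_definition uminus_grassmann :: "grassmann \<Rightarrow> grassmann" is "\<lambda>f S. - f S" by simp

definition minus_grassmann :: "grassmann \<Rightarrow> grassmann \<Rightarrow> grassmann" where
  "minus_grassmann a b = a + (- b)"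

lift_definition times_grassmann :: "grassmann \<Rightarrow> grassmann \<Rightarrow> grassmann"
  is "\<lambda>f g U. \<Sum>S\<in>Pow U. ext_sign S (U - S) * f S * g (U - S)"
proof -
  fix f g :: "nat set \<Rightarrow> complex"
  assume f: "finite {S. f S \<noteq> 0} \<and> (\<forall>S. f S \<noteq> 0 \<longrightarrow> finite S)"
    and g: "finite {S. g S \<noteq> 0} \<and> (\<forall>S. g S \<noteq> 0 \<longrightarrow> finite S)"
  let ?h = "\<lambda>U. \<Sum>S\<in>Pow U. ext_sign S (U - S) * f S * g (U - S)"
  have ex: "\<exists>S. S \<subseteq> U \<and> f S \<noteq> 0 \<and> g (U - S) \<noteq> 0" if nz: "?h U \<noteq> 0" for U
  proof (rule ccontr)
    assume "\<not> ?thesis"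
    then have "?h U = 0"
      by (intro sum.neutral) auto
    with nz show False by simp
  qed
  have "{U. ?h U \<noteq> 0} \<subseteq> (\<lambda>(S, T). S \<union> T) ` ({S. f S \<noteq> 0} \<times> {S. g S \<noteq> 0})"
  proof
    fix U assume "U \<in> {U. ?h U \<noteq> 0}"
    then obtain S where "S \<subseteq> U" "f S \<noteq> 0" "g (U - S) \<noteq> 0"
      using ex by blast
    then show "U \<in> (\<lambda>(S, T). S \<union> T) ` ({S. f S \<noteq> 0} \<times> {S. g S \<noteq> 0})"
      by (intro image_eqI[where x = "(S, U - S)"]) auto
  qed
  moreover have "finite ((\<lambda>(S, T). S \<union> T) ` ({S. f S \<noteq> 0} \<times> {S. g S \<noteq> 0}))"
    using f g by blast
  moreover have "finite U" if "?h U \<noteq> 0" for U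
    using that by (rule contrapos_np) simp
  ultimately show "finite {U. ?h U \<noteq> 0} \<and> (\<forall>U. ?h U \<noteq> 0 \<longrightarrow> finite U)"
    using finite_subset by blast
qed

instance
proof
  fix a b c :: grassmann
  show "a + b + c = a + (b + c)" by transfer (simp add: add.assoc)
  show "a + b = b + a" by transfer (simp add: add.commute)
  show "0 + a = a" by transfer simp
  show "- a + a = 0" by transfer simp
  show "a - b = a + - b" by (simp add: minus_grassmann_def)
  show "(a + b) * c = a * c + b * c"
    by transfer (simp add: distrib_left distrib_right sum.distrib)
  show "a * (b + c) = a * b + a * c"
    by transfer (simp add: distrib_left distrib_right sum.distrib)
  show "(0::grassmann) \<noteq> 1"
    by transfer (auto simp: fun_eq_iff)
  show "1 * a = a"
  proof transfer
    fix f :: "nat set \<Rightarrow> complex"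
    assume f: "finite {S. f S \<noteq> 0} \<and> (\<forall>S. f S \<noteq> 0 \<longrightarrow> finite S)"
    have "(\<Sum>S\<in>Pow U. ext_sign S (U - S) * (if S = {} then 1 else 0) * f (U - S)) = f U" for U
    proof (cases "finite U")
      case True
      have "(\<Sum>S\<in>Pow U. ext_sign S (U - S) * (if S = {} then 1 else 0) * f (U - S)) =
          (\<Sum>S\<in>Pow U. if S = {} then f U else 0)"
        by (rule sum.cong) auto
      also have "\<dots> = f U"
        using True by (subst sum.delta) auto
      finally show ?thesis .
    next
      case False
      then have "f U = 0" using f by blast
      with False show ?thesis by simp
    qed
    then show "(\<lambda>U. \<Sum>S\<in>Pow U. ext_sign S (U - S) * (if S = {} then 1 else 0) * f (U - S)) = f"
      by blast
  qed
  show "a * 1 = a"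
  proof transfer
    fix f :: "nat set \<Rightarrow> complex"
    assume f: "finite {S. f S \<noteq> 0} \<and> (\<forall>S. f S \<noteq> 0 \<longrightarrow> finite S)"
    have "(\<Sum>S\<in>Pow U. ext_sign S (U - S) * f S * (if U - S = {} then 1 else 0)) = f U" for U
    proof (cases "finite U")
      case True
      have "(\<Sum>S\<in>Pow U. ext_sign S (U - S) * f S * (if U - S = {} then 1 else 0)) =
          (\<Sum>S\<in>Pow U. if S = U then f U else 0)"
        by (rule sum.cong) auto
      also have "\<dots> = f U"
        using True by (subst sum.delta) auto
      finally show ?thesis .
    next
      case False
      then have "f U = 0" using f by blast
      with False show ?thesis by simp
    qed
    then show "(\<lambda>U. \<Sum>S\<in>Pow U. ext_sign S (U - S) * f S * (if U - S = {} then 1 else 0)) = f"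
      by blast
  qed
  show "a * b * c = a * (b * c)"
  proof transfer
    fix f g h :: "nat set \<Rightarrow> complex"
    let ?l = "\<lambda>U. \<Sum>V\<in>Pow U. ext_sign V (U - V) *
      (\<Sum>S\<in>Pow V. ext_sign S (V - S) * f S * g (V - S)) * h (U - V)"
    let ?r = "\<lambda>U. \<Sum>S\<in>Pow U. ext_sign S (U - S) * f S *
      (\<Sum>W\<in>Pow (U - S). ext_sign W (U - S - W) * g W * h (U - S - W))"
    have "?l U = ?r U" for U
    proof (cases "finite U")
      case True
      have fin: "\<And>X. X \<subseteq> U \<Longrightarrow> finite X"
        using True finite_subset by blast
      have "?l U = (\<Sum>V\<in>Pow U. \<Sum>S\<in>Pow V.
          ext_sign V (U - V) * ext_sign S (V - S) * f S * g (V - S) * h (U - V))"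
        by (simp add: sum_distrib_left sum_distrib_right mult.assoc)
      also have "\<dots> = (\<Sum>(V, S)\<in>Sigma (Pow U) Pow.
          ext_sign V (U - V) * ext_sign S (V - S) * f S * g (V - S) * h (U - V))"
        by (rule sum.Sigma) (use True fin in auto)
      also have "\<dots> = (\<Sum>(S, W)\<in>Sigma (Pow U) (\<lambda>S. Pow (U - S)).
          ext_sign S (U - S) * ext_sign W (U - S - W) * f S * g W * h (U - S - W))"
      proof (rule sum.reindex_bij_witness[where i = "\<lambda>(S, W). (S \<union> W, S)" and j = "\<lambda>(V, S). (S, V - S)"],
             goal_cases)
        case (5 p)
        obtain V S where p: "p = (V, S)" "V \<subseteq> U" "S \<subseteq> V" using 5 by auto
        define W T where "W = V - S" and "T = U - V"
        have V: "V = S \<union> W" and US: "U - S = W \<union> T" and "U - S - W = T"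
          and dis: "S \<inter> W = {}" "W \<inter> T = {}"
          using p by (auto simp: W_def T_def)
        have [simp]: "finite S" "finite W" "finite T"
          using p fin by (auto simp: W_def T_def intro!: fin)
        have "ext_sign V T * ext_sign S W = ext_sign S (W \<union> T) * ext_sign W T"
          unfolding V using dis by (simp add: ext_sign_union_left ext_sign_union_right)
        then show ?case
          using \<open>U - S - W = T\<close> US by (simp add: p W_def[symmetric] T_def[symmetric])
      qed auto
      also have "\<dots> = (\<Sum>S\<in>Pow U. \<Sum>W\<in>Pow (U - S).
          ext_sign S (U - S) * ext_sign W (U - S - W) * f S * g W * h (U - S - W))"
        by (rule sum.Sigma[symmetric]) (use True in auto)
      also have "\<dots> = ?r U"
        by (simp add: sum_distrib_left sum_distrib_right mult_ac)
      finally show ?thesis .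
    next
      case False
      then show ?thesis by simp
    qed
    then show "?l = ?r" by blast
  qed
qed

end

lift_definition gconst :: "complex \<Rightarrow> grassmann" is "\<lambda>c S. if S = {} then c else 0"
  by simp

text \<open>The grading involution: \<open>+1\<close> on even and \<open>-1\<close> on odd elements.\<close>

lift_definition gbar :: "grassmann \<Rightarrow> grassmann" is "\<lambda>f S. (-1) ^ card S * f S"
  by simp

text \<open>
  \<open>\<Lambda> (enat N)\<close> is the exterior algebra on the first \<open>N\<close> generators and \<open>\<Lambda> \<infinity>\<close> is the union
  of these. Throughout, a parameter \<open>L :: enat\<close> stands for the choice of \<open>\<Lambda>\<^sub>*\<close>. Parities are
  natural numbers, of which only the residue mod 2 matters.
\<close>

definition Grass :: "enat \<Rightarrow> grassmann set" ("\<Lambda>") where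
  "\<Lambda> L = {a. \<forall>S. gcoeff a S \<noteq> 0 \<longrightarrow> (\<forall>i\<in>S. enat i < L)}"

definition Grass_part :: "enat \<Rightarrow> nat \<Rightarrow> grassmann set" where
  "Grass_part L p = {a \<in> \<Lambda> L. \<forall>S. gcoeff a S \<noteq> 0 \<longrightarrow> (even (card S) \<longleftrightarrow> even p)}"

abbreviation Grass_even :: "enat \<Rightarrow> grassmann set" ("\<Lambda>\<^sup>0") where
  "\<Lambda>\<^sup>0 L \<equiv> Grass_part L 0"

abbreviation Grass_odd :: "enat \<Rightarrow> grassmann set" ("\<Lambda>\<^sup>1") where
  "\<Lambda>\<^sup>1 L \<equiv> Grass_part L 1"

definition even_monoid :: "enat \<Rightarrow> grassmann monoid" where
  "even_monoid L = \<lparr>carrier = \<Lambda>\<^sup>0 L, monoid.mult = (*), one = 1\<rparr>"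

definition even_units :: "enat \<Rightarrow> grassmann monoid" where
  "even_units L = units_of (even_monoid L)"


section \<open>Formal series in an even and an odd variable\<close>

text \<open>
  \<open>Superseries a b\<close> is the formal series \<open>(\<Sum>n. a n x^n) + \<phi> (\<Sum>n. b n x^n)\<close>, \<open>n\<close> ranging
  over the integers. Coefficients stand to the right of \<open>\<phi>\<close>, which is where the
  involution \<open>gbar\<close> comes from: \<open>c \<phi> = \<phi> (gbar c)\<close> for \<open>c \<in> \<Lambda>\<^sub>*\<close>.
\<close>

datatype superseries = Superseries (cf0: "int \<Rightarrow> grassmann") (cf1: "int \<Rightarrow> grassmann")

instantiation superseries :: ab_group_add
begin

definition "0 = Superseries (\<lambda>_. 0) (\<lambda>_. 0)"
definition "u + v = Superseries (\<lambda>n. cf0 u n + cf0 v n) (\<lambda>n. cf1 u n + cf1 v n)"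
definition "- u = Superseries (\<lambda>n. - cf0 u n) (\<lambda>n. - cf1 u n)"
definition "u - v = Superseries (\<lambda>n. cf0 u n - cf0 v n) (\<lambda>n. cf1 u n - cf1 v n)"

instance
  by standard
    (auto simp: zero_superseries_def plus_superseries_def uminus_superseries_def
      minus_superseries_def algebra_simps)

end

definition smul :: "grassmann \<Rightarrow> superseries \<Rightarrow> superseries" (infixr "*\<^sub>\<Lambda>" 75) where
  "c *\<^sub>\<Lambda> u = Superseries (\<lambda>n. c * cf0 u n) (\<lambda>n. gbar c * cf1 u n)"

definition cmul :: "complex \<Rightarrow> superseries \<Rightarrow> superseries" (infixr "*\<^sub>\<complex>" 75) where
  "c *\<^sub>\<complex> u = gconst c *\<^sub>\<Lambda> u"

text \<open>The series with \<open>x\<close>-exponents of the two parts in \<open>I\<close>, \<open>J\<close> and coefficients in \<open>A\<close>, \<open>B\<close>.\<close>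

definition series_in ::
  "int set \<Rightarrow> grassmann set \<Rightarrow> int set \<Rightarrow> grassmann set \<Rightarrow> superseries set" where
  "series_in I A J B = {u.
     (\<forall>n. cf0 u n \<in> A) \<and> (\<forall>n. n \<notin> I \<longrightarrow> cf0 u n = 0) \<and>
     (\<forall>n. cf1 u n \<in> B) \<and> (\<forall>n. n \<notin> J \<longrightarrow> cf1 u n = 0)}"

text \<open>\<open>\<Lambda>\<^sub>*[[x, x\<inverse>]][\<phi>]\<close> and its homogeneous parts.\<close>

definition SSeries :: "enat \<Rightarrow> superseries set" where
  "SSeries L = series_in UNIV (\<Lambda> L) UNIV (\<Lambda> L)"

definition SSeries_part :: "enat \<Rightarrow> nat \<Rightarrow> superseries set" where
  "SSeries_part L p = series_in UNIV (Grass_part L p) UNIV (Grass_part L (Suc p))"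

definition ss_one :: superseries where
  "ss_one = Superseries (\<lambda>n. if n = 0 then 1 else 0) (\<lambda>_. 0)"

definition var_x :: superseries where
  "var_x = Superseries (\<lambda>n. if n = 1 then 1 else 0) (\<lambda>_. 0)"

definition var_phi :: superseries where
  "var_phi = Superseries (\<lambda>_. 0) (\<lambda>n. if n = 0 then 1 else 0)"

text \<open>
  The space of doubly infinite series is not closed under multiplication: a product exists if
  only finitely many pairs of terms contribute to each power of \<open>x\<close>. In the definition of
  \<open>ss_mult\<close>, \<open>(a + \<phi> b) (a' + \<phi> b') = a a' + \<phi> (b a' + gbar a b')\<close>.
\<close>

definition mult_exists :: "superseries \<Rightarrow> superseries \<Rightarrow> bool" where
  "mult_exists u v \<longleftrightarrow>
     (\<forall>f \<in> {cf0 u, cf1 u}. \<forall>g \<in> {cf0 v, cf1 v}. \<forall>n. finite {k. f k \<noteq> 0 \<and> g (n - k) \<noteq> 0})"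

definition conv :: "(int \<Rightarrow> grassmann) \<Rightarrow> (int \<Rightarrow> grassmann) \<Rightarrow> int \<Rightarrow> grassmann" where
  "conv f g n = (\<Sum>k | f k \<noteq> 0 \<and> g (n - k) \<noteq> 0. f k * g (n - k))"

definition ss_mult :: "superseries \<Rightarrow> superseries \<Rightarrow> superseries" where
  "ss_mult u v = Superseries
     (conv (cf0 u) (cf0 v))
     (\<lambda>n. conv (cf1 u) (cf0 v) n + conv (\<lambda>k. gbar (cf0 u k)) (cf1 v) n)"

text \<open>Infinite sums of series are formal: each coefficient has to be a finite sum.\<close>

definition fsummable :: "'i set \<Rightarrow> ('i \<Rightarrow> superseries) \<Rightarrow> bool" where
  "fsummable I u \<longleftrightarrow>
     (\<forall>n. finite {i \<in> I. cf0 (u i) n \<noteq> 0} \<and> finite {i \<in> I. cf1 (u i) n \<noteq> 0})"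

definition fsum :: "'i set \<Rightarrow> ('i \<Rightarrow> superseries) \<Rightarrow> superseries" where
  "fsum I u = Superseries
     (\<lambda>n. \<Sum>i | i \<in> I \<and> cf0 (u i) n \<noteq> 0. cf0 (u i) n)
     (\<lambda>n. \<Sum>i | i \<in> I \<and> cf1 (u i) n \<noteq> 0. cf1 (u i) n)"


section \<open>Superderivations and the N=2 Neveu-Schwarz algebra\<close>

definition super_endo :: "enat \<Rightarrow> nat \<Rightarrow> (superseries \<Rightarrow> superseries) \<Rightarrow> bool" where
  "super_endo L p D \<longleftrightarrow>
     D ` SSeries L \<subseteq> SSeries L \<and>
     (\<forall>q. D ` SSeries_part L q \<subseteq> SSeries_part L (p + q)) \<and>
     (\<forall>u \<in> SSeries L. \<forall>v \<in> SSeries L. D (u + v) = D u + D v) \<and>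
     (\<forall>c. \<forall>u \<in> SSeries L. D (c *\<^sub>\<complex> u) = c *\<^sub>\<complex> D u)"

text \<open>Homogeneous elements of parity \<open>p\<close> of \<open>Der (\<Lambda>\<^sub>*[[x, x\<inverse>]][\<phi>])\<close>.\<close>

definition superderivation :: "enat \<Rightarrow> nat \<Rightarrow> (superseries \<Rightarrow> superseries) \<Rightarrow> bool" where
  "superderivation L p D \<longleftrightarrow>
     super_endo L p D \<and>
     (\<forall>q. \<forall>u \<in> SSeries_part L q. \<forall>v \<in> SSeries L. mult_exists u v \<longrightarrow>
        mult_exists (D u) v \<and> mult_exists u (D v) \<and>
        D (ss_mult u v) = ss_mult (D u) v + (-1) ^ (p * q) *\<^sub>\<complex> ss_mult u (D v))"

text \<open>
  The operators by which \<open>L\<^sub>n\<close>, \<open>J\<^sub>n\<close> and the odd elements of the nonhomogeneous basis act on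
  \<open>\<Lambda>\<^sub>*[[x, x\<inverse>]][\<phi>]\<close>; \<open>d\<close> acts as the scalar \<open>c\<close>. Half-integer indices are shifted:
  \<open>Gj n\<close> represents the basis element with index \<open>n - 1/2\<close>.
\<close>

definition NS2_representation ::
  "enat \<Rightarrow> complex \<Rightarrow> (int \<Rightarrow> superseries \<Rightarrow> superseries) \<Rightarrow> (int \<Rightarrow> superseries \<Rightarrow> superseries) \<Rightarrow>
   (nat \<Rightarrow> int \<Rightarrow> superseries \<Rightarrow> superseries) \<Rightarrow> bool" where
  "NS2_representation L c Lf Jf Gf \<longleftrightarrow>
     (\<forall>n. super_endo L 0 (Lf n) \<and> super_endo L 0 (Jf n) \<and>
          super_endo L 1 (Gf 1 n) \<and> super_endo L 1 (Gf 2 n)) \<and>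
     (\<forall>m n. \<forall>u \<in> SSeries L.
        let comm = (\<lambda>D E. D (E u) - E (D u)); anticomm = (\<lambda>D E. D (E u) + E (D u));
            \<delta> = (if m + n = 0 then 1 else 0) in
        comm (Lf m) (Lf n) = of_int (m - n) *\<^sub>\<complex> Lf (m + n) u
            + (of_int (m ^ 3 - m) / 12 * \<delta> * c) *\<^sub>\<complex> u \<and>
        comm (Jf m) (Jf n) = (of_int m / 3 * \<delta> * c) *\<^sub>\<complex> u \<and>
        comm (Lf m) (Jf n) = of_int (- n) *\<^sub>\<complex> Jf (m + n) u \<and>
        (\<forall>j \<in> {1, 2}. comm (Lf m) (Gf j (n + 1)) =
            (of_int m / 2 - of_int n - 1 / 2) *\<^sub>\<complex> Gf j (m + n + 1) u) \<and>
        comm (Jf m) (Gf 1 (n + 1)) = (- \<i>) *\<^sub>\<complex> Gf 2 (m + n + 1) u \<and>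
        comm (Jf m) (Gf 2 (n + 1)) = \<i> *\<^sub>\<complex> Gf 1 (m + n + 1) u \<and>
        (\<forall>j \<in> {1, 2}. anticomm (Gf j (m + 1)) (Gf j n) =
            2 *\<^sub>\<complex> Lf (m + n) u + (of_int (m ^ 2 + m) / 3 * \<delta> * c) *\<^sub>\<complex> u) \<and>
        anticomm (Gf 1 (m + 1)) (Gf 2 n) = (- \<i> * of_int (m - n + 1)) *\<^sub>\<complex> Jf (m + n) u)"

definition xpow :: "int \<Rightarrow> superseries \<Rightarrow> superseries" where
  "xpow k u = Superseries (\<lambda>n. cf0 u (n - k)) (\<lambda>n. cf1 u (n - k))"

definition phi_mult :: "superseries \<Rightarrow> superseries" where
  "phi_mult u = Superseries (\<lambda>_. 0) (cf0 u)"

definition ddx :: "superseries \<Rightarrow> superseries" where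
  "ddx u = Superseries (\<lambda>n. of_int (n + 1) * cf0 u (n + 1)) (\<lambda>n. of_int (n + 1) * cf1 u (n + 1))"

definition ddphi :: "superseries \<Rightarrow> superseries" where
  "ddphi u = Superseries (cf1 u) (\<lambda>_. 0)"

definition Lop :: "int \<Rightarrow> superseries \<Rightarrow> superseries" where
  "Lop n u = - (xpow (n + 1) (ddx u) + (of_int (n + 1) / 2) *\<^sub>\<complex> xpow n (phi_mult (ddphi u)))"

definition Jop :: "int \<Rightarrow> superseries \<Rightarrow> superseries" where
  "Jop n u = xpow n (phi_mult (ddphi u))"

text \<open>\<open>Gop j n\<close> is the superderivation with upper index \<open>(j)\<close> and lower index \<open>n - 1/2\<close>.\<close>

definition Gop :: "nat \<Rightarrow> int \<Rightarrow> superseries \<Rightarrow> superseries" where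
  "Gop j n u = ((- \<i>) ^ (j + 1)) *\<^sub>\<complex> xpow n (ddphi u + (-1) ^ j *\<^sub>\<complex> phi_mult (ddx u))"


section \<open>Superanalytic functions\<close>

definition superanalytic :: "enat \<Rightarrow> (superseries \<times> superseries) set" where
  "superanalytic L = SSeries_part L 0 \<times> SSeries_part L 1"

definition invertible_zero :: "enat \<Rightarrow> superseries \<times> superseries \<Rightarrow> bool" where
  "invertible_zero L f \<longleftrightarrow>
     cf0 (fst f) 1 \<in> Units (even_monoid L) \<and> cf1 (snd f) 0 \<in> Units (even_monoid L)"

text \<open>The substitution \<open>u(x, \<phi>) \<mapsto> u(1/x, -i\<phi>/x)\<close>: it sends \<open>\<phi> x^m b\<close> to \<open>-i \<phi> x^(-m-1) b\<close>.\<close>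

definition subst_inversion :: "superseries \<Rightarrow> superseries" where
  "subst_inversion u = Superseries (\<lambda>n. cf0 u (- n)) (\<lambda>n. gconst (- \<i>) * cf1 u (- n - 1))"

definition invertible_infinity :: "enat \<Rightarrow> superseries \<times> superseries \<Rightarrow> bool" where
  "invertible_infinity L f \<longleftrightarrow> invertible_zero L (map_prod subst_inversion subst_inversion f)"

definition functions_zero :: "enat \<Rightarrow> (superseries \<times> superseries) set" where
  "functions_zero L = {f \<in> superanalytic L.
     f \<in> series_in {1..} (\<Lambda>\<^sup>0 L) {1..} (\<Lambda>\<^sup>1 L) \<times> series_in {1..} (\<Lambda>\<^sup>1 L) {0..} (\<Lambda>\<^sup>0 L) \<and>
     invertible_zero L f}"

definition functions_infinity :: "enat \<Rightarrow> (superseries \<times> superseries) set" where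
  "functions_infinity L = {f \<in> superanalytic L.
     f \<in> series_in {..-1} (\<Lambda>\<^sup>0 L) {..-2} (\<Lambda>\<^sup>1 L) \<times> series_in {..-1} (\<Lambda>\<^sup>1 L) {..-1} (\<Lambda>\<^sup>0 L) \<and>
     invertible_infinity L f}"


section \<open>Exponential expressions\<close>

text \<open>The automorphism \<open>x \<mapsto> a x, \<phi> \<mapsto> b \<phi>\<close> for even units \<open>a\<close>, \<open>b\<close>.\<close>

definition rescale :: "enat \<Rightarrow> grassmann \<Rightarrow> grassmann \<Rightarrow> superseries \<Rightarrow> superseries" where
  "rescale L a b u = Superseries
     (\<lambda>n. (a [^]\<^bsub>even_units L\<^esub> n) * cf0 u n)
     (\<lambda>n. (a [^]\<^bsub>even_units L\<^esub> n) * b * cf1 u n)"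

definition pow_minus_2L0 :: "enat \<Rightarrow> grassmann \<Rightarrow> superseries \<Rightarrow> superseries" where
  "pow_minus_2L0 L a = rescale L (a * a) a"

definition pow_2L0 :: "enat \<Rightarrow> grassmann \<Rightarrow> superseries \<Rightarrow> superseries" where
  "pow_2L0 L a = pow_minus_2L0 L (inv\<^bsub>even_units L\<^esub> a)"

definition pow_minus_J0 :: "enat \<Rightarrow> grassmann \<Rightarrow> superseries \<Rightarrow> superseries" where
  "pow_minus_J0 L a = rescale L 1 (inv\<^bsub>even_units L\<^esub> a)"

definition exp_op :: "(superseries \<Rightarrow> superseries) \<Rightarrow> superseries \<Rightarrow> superseries" where
  "exp_op T u = fsum UNIV (\<lambda>k::nat. (1 / fact k) *\<^sub>\<complex> (T ^^ k) u)"

text \<open>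
  \<open>exp (\<Sum>n\<in>\<int>\<^sub>+. D n)\<close> is well-defined on \<open>u\<close>: all formal sums occurring in it exist.
\<close>

definition exp_sum_exists :: "(nat \<Rightarrow> superseries \<Rightarrow> superseries) \<Rightarrow> superseries \<Rightarrow> bool" where
  "exp_sum_exists D u \<longleftrightarrow> (let T = (\<lambda>w. fsum {1..} (\<lambda>n. D n w)) in
     (\<forall>k. fsummable {1..} (\<lambda>n. D n ((T ^^ k) u))) \<and>
     fsummable UNIV (\<lambda>k::nat. (1 / fact k) *\<^sub>\<complex> (T ^^ k) u))"

definition exp_sum :: "(nat \<Rightarrow> superseries \<Rightarrow> superseries) \<Rightarrow> superseries \<Rightarrow> superseries" where
  "exp_sum D = exp_op (\<lambda>w. fsum {1..} (\<lambda>n. D n w))"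

type_synonym gseq = "nat \<Rightarrow> grassmann"

text \<open>The value at \<open>n \<ge> 1\<close> of the sequence \<open>Mj\<close> is the parameter with lower index \<open>n - 1/2\<close>.\<close>

definition terms_zero ::
  "gseq \<Rightarrow> gseq \<Rightarrow> gseq \<Rightarrow> gseq \<Rightarrow> nat \<Rightarrow> superseries \<Rightarrow> superseries" where
  "terms_zero A1 A2 M1 M2 n u =
     - (A1 n *\<^sub>\<Lambda> Lop (int n) u + A2 n *\<^sub>\<Lambda> Jop (int n) u
        + M1 n *\<^sub>\<Lambda> Gop 1 (int n) u + M2 n *\<^sub>\<Lambda> Gop 2 (int n) u)"

definition terms_infinity ::
  "gseq \<Rightarrow> gseq \<Rightarrow> gseq \<Rightarrow> gseq \<Rightarrow> nat \<Rightarrow> superseries \<Rightarrow> superseries" where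
  "terms_infinity A1 A2 M1 M2 n u =
     A1 n *\<^sub>\<Lambda> Lop (- int n) u - A2 n *\<^sub>\<Lambda> Jop (- int n) u
     + \<i> *\<^sub>\<complex> M1 n *\<^sub>\<Lambda> Gop 1 (1 - int n) u + \<i> *\<^sub>\<complex> M2 n *\<^sub>\<Lambda> Gop 2 (1 - int n) u"

text \<open>What the exponentials are applied to; operators act on both components of a pair.\<close>

definition base_zero :: "enat \<Rightarrow> grassmann \<times> grassmann \<Rightarrow> superseries \<times> superseries" where
  "base_zero L = (\<lambda>(a1, a2).
     let R = pow_minus_2L0 L a1 \<circ> pow_minus_J0 L a2 in map_prod R R (var_x, var_phi))"

definition base_infinity :: "enat \<Rightarrow> grassmann \<times> grassmann \<Rightarrow> superseries \<times> superseries" where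
  "base_infinity L = (\<lambda>(a1, a2).
     let R = pow_2L0 L a1 \<circ> pow_minus_J0 L a2
     in map_prod R R (xpow (-1) ss_one, \<i> *\<^sub>\<complex> xpow (-1) var_phi))"

definition expression_zero ::
  "enat \<Rightarrow> grassmann \<times> grassmann \<Rightarrow> gseq \<Rightarrow> gseq \<Rightarrow> gseq \<Rightarrow> gseq \<Rightarrow> superseries \<times> superseries" where
  "expression_zero L a A1 A2 M1 M2 =
     (let E = exp_sum (terms_zero A1 A2 M1 M2) in map_prod E E (base_zero L a))"

definition expression_infinity ::
  "enat \<Rightarrow> grassmann \<times> grassmann \<Rightarrow> gseq \<Rightarrow> gseq \<Rightarrow> gseq \<Rightarrow> gseq \<Rightarrow> superseries \<times> superseries" where
  "expression_infinity L a A1 A2 M1 M2 =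
     (let E = exp_sum (terms_infinity A1 A2 M1 M2) in map_prod E E (base_infinity L a))"

definition expression_zero_exists ::
  "enat \<Rightarrow> grassmann \<times> grassmann \<Rightarrow> gseq \<Rightarrow> gseq \<Rightarrow> gseq \<Rightarrow> gseq \<Rightarrow> bool" where
  "expression_zero_exists L a A1 A2 M1 M2 \<longleftrightarrow>
     exp_sum_exists (terms_zero A1 A2 M1 M2) (fst (base_zero L a)) \<and>
     exp_sum_exists (terms_zero A1 A2 M1 M2) (snd (base_zero L a))"

definition expression_infinity_exists ::
  "enat \<Rightarrow> grassmann \<times> grassmann \<Rightarrow> gseq \<Rightarrow> gseq \<Rightarrow> gseq \<Rightarrow> gseq \<Rightarrow> bool" where
  "expression_infinity_exists L a A1 A2 M1 M2 \<longleftrightarrow>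
     exp_sum_exists (terms_infinity A1 A2 M1 M2) (fst (base_infinity L a)) \<and>
     exp_sum_exists (terms_infinity A1 A2 M1 M2) (snd (base_infinity L a))"

definition unit_pairs :: "enat \<Rightarrow> (grassmann \<times> grassmann) monoid" where
  "unit_pairs L = even_units L \<times>\<times> even_units L"

definition sign_subgroup :: "enat \<Rightarrow> (grassmann \<times> grassmann) set" where
  "sign_subgroup L = generate (unit_pairs L) {(-1, -1)}"

definition even_seqs :: "enat \<Rightarrow> gseq set" where
  "even_seqs L = {1..} \<rightarrow>\<^sub>E \<Lambda>\<^sup>0 L"

definition odd_seqs :: "enat \<Rightarrow> gseq set" where
  "odd_seqs L = {1..} \<rightarrow>\<^sub>E \<Lambda>\<^sup>1 L"

definition parameters ::
  "enat \<Rightarrow> ((grassmann \<times> grassmann) set \<times> gseq \<times> gseq \<times> gseq \<times> gseq) set" where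
  "parameters L = carrier (unit_pairs L Mod sign_subgroup L)
     \<times> even_seqs L \<times> even_seqs L \<times> odd_seqs L \<times> odd_seqs L"

end

theory Submission
  imports Defs "HOL-Computational_Algebra.Formal_Power_Series"
begin

text \<open>
  Give \<open>x^m\<close> weight \<open>2 m\<close> and \<open>\<phi> x^m\<close> weight \<open>2 m + 1\<close>. The parameters \<open>A\<^sub>n\<close> enter the exponent in operators
  raising the weight by \<open>2 n\<close>, the \<open>M\<close> with index \<open>n - 1/2\<close> in operators raising it by \<open>2 n - 1\<close>, so
  the exponent is strictly triangular and its exponential is locally a finite sum. The two
  parameters at level \<open>l\<close> contribute linearly and invertibly to the two coefficients lying \<open>l\<close> steps
  above the leading terms \<open>a\<^sub>1\<^sup>2 x\<close> and \<open>(a\<^sub>1 / a\<^sub>2) \<phi>\<close>; everything else in these coefficients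
  depends on lower levels only, so the parameters can be recovered recursively. The leading
  coefficients determine \<open>(a\<^sub>1, a\<^sub>2)\<close> up to a common sign because invertible even elements have exactly two
  square roots. The substitution \<open>(x, \<phi>) \<mapsto> (1/x, -i\<phi>/x)\<close> conjugates the exponents at
  infinity into those at zero, which reduces the second bijection to the first.
\<close>

section \<open>Arithmetic of the Grassmann algebra\<close>

text \<open>The operators in the exponent do not commute, so its exponential has no convenient
  closed form. Only the part linear in the exponent matters: a product of two or more weight-raising
  operators with total shift \<open>l\<close> involves levels below \<open>l\<close> alone. The
  parameters of level \<open>l\<close> are therefore replaced by the pair of coefficients that the
  exponent produces at that level from \<phi> and from x. In these coordinates the new unknowns are
  merely multiplied by the leading units, so each level is solved by a subtraction and a division.
  The change of coordinates is a 2 by 2 linear map over \<complex>, separately for even and odd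
  levels. Odd parameters anticommute with \<phi>, but the signs in the odd operators are such that
  every parameter ends up acting by plain left multiplication on coefficients. Infinitely many
  generators do no harm: each single element uses finitely many, so it is a constant plus a
  nilpotent, which decides invertibility and gives square roots of even units.\<close>

lemma grassmann_eqI: "(\<And>S. gcoeff a S = gcoeff b S) \<Longrightarrow> a = b"
  by (simp add: gcoeff_inject[symmetric] fun_eq_iff)

lemma gcoeff_zero [simp]: "gcoeff 0 S = 0"
  and gcoeff_one: "gcoeff 1 S = (if S = {} then 1 else 0)"
  and gcoeff_add [simp]: "gcoeff (a + b) S = gcoeff a S + gcoeff b S"
  and gcoeff_uminus [simp]: "gcoeff (- a) S = - gcoeff a S"
  and gcoeff_mult: "gcoeff (a * b) S = (\<Sum>T\<in>Pow S. ext_sign T (S - T) * gcoeff a T * gcoeff b (S - T))"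
  and gcoeff_gconst: "gcoeff (gconst c) S = (if S = {} then c else 0)"
  and gcoeff_gbar [simp]: "gcoeff (gbar a) S = (-1) ^ card S * gcoeff a S"
  by (transfer, simp)+

lemma gcoeff_diff [simp]: "gcoeff (a - b) S = gcoeff a S - gcoeff b S"
  by (simp add: diff_conv_add_uminus del: add_uminus_conv_diff)

lemma gcoeff_infinite: "infinite S \<Longrightarrow> gcoeff a S = 0"
  by transfer auto

lemma finite_gcoeff_support: "finite {S. gcoeff a S \<noteq> 0}"
  by transfer auto

lemma gcoeff_gconst_mult [simp]: "gcoeff (gconst c * a) S = c * gcoeff a S"
proof (cases "finite S")
  case True
  have "gcoeff (gconst c * a) S = (\<Sum>T\<in>Pow S. if T = {} then c * gcoeff a S else 0)"
    unfolding gcoeff_mult by (rule sum.cong) (auto simp: gcoeff_gconst)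
  with True show ?thesis by simp
qed (simp add: gcoeff_infinite)

lemma gcoeff_mult_gconst [simp]: "gcoeff (a * gconst c) S = c * gcoeff a S"
proof (cases "finite S")
  case True
  have "gcoeff (a * gconst c) S = (\<Sum>T\<in>Pow S. if T = S then c * gcoeff a S else 0)"
    unfolding gcoeff_mult by (rule sum.cong) (auto simp: gcoeff_gconst)
  with True show ?thesis by simp
qed (simp add: gcoeff_infinite)

lemma gconst_commute: "a * gconst c = gconst c * a"
  by (rule grassmann_eqI) simp

lemma gconst_left_commute: "a * (gconst c * b) = gconst c * (a * b)"
  by (metis gconst_commute mult.assoc)

lemma gconst_0 [simp]: "gconst 0 = 0" and gconst_1 [simp]: "gconst 1 = 1"
  and gconst_add: "gconst (c + d) = gconst c + gconst d"
  and gconst_uminus: "gconst (- c) = - gconst c"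
  and gconst_diff: "gconst (c - d) = gconst c - gconst d"
  and gconst_mult: "gconst (c * d) = gconst c * gconst d"
  by (rule grassmann_eqI, simp add: gcoeff_gconst gcoeff_one)+

lemma gconst_of_nat: "gconst (of_nat n) = of_nat n"
  by (induction n) (simp_all add: gconst_add)

lemma gconst_of_int: "gconst (of_int n) = of_int n"
  by (cases n) (simp_all add: gconst_uminus gconst_diff gconst_of_nat)

lemma gcoeff_of_int_mult [simp]: "gcoeff (of_int n * a) S = of_int n * gcoeff a S"
  by (simp flip: gconst_of_int)

lemma gcoeff_of_nat_mult [simp]: "gcoeff (of_nat n * a) S = of_nat n * gcoeff a S"
  by (simp flip: gconst_of_nat)

lemma gbar_0 [simp]: "gbar 0 = 0"
  and gbar_add: "gbar (a + b) = gbar a + gbar b"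
  and gbar_gconst [simp]: "gbar (gconst c) = gconst c"
  and gbar_gbar [simp]: "gbar (gbar a) = a"
  by (rule grassmann_eqI, simp add: gcoeff_gconst distrib_left flip: mult.assoc power_mult_distrib)+

lemma gbar_mult: "gbar (a * b) = gbar a * gbar b"
proof (rule grassmann_eqI)
  fix S
  show "gcoeff (gbar (a * b)) S = gcoeff (gbar a * gbar b) S"
  proof (cases "finite S")
    case True
    have "card S = card T + card (S - T)" if "T \<subseteq> S" for T
      using that True by (metis card_Diff_subset card_mono finite_subset le_add_diff_inverse)
    then show ?thesis
      by (auto simp: gcoeff_mult sum_distrib_left power_add intro!: sum.cong)
  qed (simp add: gcoeff_infinite)
qed

lemma gbar_eq_0_iff [simp]: "gbar a = 0 \<longleftrightarrow> a = 0"
  by (metis gbar_0 gbar_gbar)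

lemma gbar_of_int_mult: "gbar (of_int n * a) = of_int n * gbar a"
  by (rule grassmann_eqI) simp

section \<open>Signs, parities and commutation\<close>

lemma ext_sign_swap:
  assumes "finite S" "finite T" "S \<inter> T = {}"
  shows "ext_sign S T = (-1) ^ (card S * card T) * ext_sign T S"
proof -
  let ?X = "{(s, t). s \<in> S \<and> t \<in> T \<and> t < s}" and ?Y = "{(t, s). t \<in> T \<and> s \<in> S \<and> s < t}"
  \<comment> \<open>For distinct generators exactly one of the two orders is an inversion, so each
    pair is an inversion of (S, T) or, swapped, of (T, S).\<close>
  have "S \<times> T = ?X \<union> prod.swap ` ?Y"
    using assms(3) by (force simp: image_iff)
  moreover have "finite ?X" by (rule finite_subset[of _ "S \<times> T"]) (use assms in auto)
  moreover have "finite ?Y" by (rule finite_subset[of _ "T \<times> S"]) (use assms in auto)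
  ultimately have "card (S \<times> T) = card ?X + card (prod.swap ` ?Y)"
    by (subst card_Un_disjoint[symmetric]) auto
  then have "card S * card T = card ?X + card ?Y"
    by (simp add: card_cartesian_product card_image)
  then have "card S * card T + card ?Y = card ?X + 2 * card ?Y" by simp
  then have "(-1 :: complex) ^ (card S * card T) * (-1) ^ card ?Y = (-1) ^ card ?X"
    by (simp flip: power_add) (simp add: power_add power_mult)
  then show ?thesis by (simp add: ext_sign_def)
qed

lemma Grass_part_gcoeff: "a \<in> Grass_part L p \<Longrightarrow> even (card S) \<noteq> even p \<Longrightarrow> gcoeff a S = 0"
  unfolding Grass_part_def by auto

text \<open>Swapping two monomials costs -1 to the product of their degrees, which is 1 as soon as
  one degree is even; so even elements commute with the whole algebra. Reindexing by complements
  exchanges the factors.\<close>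

lemma Grass_part_commute:
  assumes "even p" "a \<in> Grass_part L p"
  shows "a * b = b * a"
proof (rule grassmann_eqI)
  fix S
  show "gcoeff (a * b) S = gcoeff (b * a) S"
  proof (cases "finite S")
    case True
    have "ext_sign T (S - T) * gcoeff a T = ext_sign (S - T) T * gcoeff a T" if "T \<subseteq> S" for T
    proof (cases "even (card T)")
      case True
      have "finite T" using that \<open>finite S\<close> by (rule finite_subset)
      with True \<open>finite S\<close> show ?thesis
        by (subst ext_sign_swap) (auto simp: Int_Diff)
    next
      case False
      with assms show ?thesis by (auto simp: Grass_part_gcoeff)
    qed
    then have "gcoeff (a * b) S = (\<Sum>T\<in>Pow S. ext_sign (S - T) T * gcoeff b (S - T) * gcoeff a T)"
      unfolding gcoeff_mult by (intro sum.cong) auto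
    also have "\<dots> = gcoeff (b * a) S"
      unfolding gcoeff_mult
      by (rule sum.reindex_bij_witness[of _ "\<lambda>T. S - T" "\<lambda>T. S - T"]) (auto simp: double_diff)
    finally show ?thesis .
  qed (simp add: gcoeff_infinite)
qed

text \<open>On homogeneous elements the involution is a complex scalar. The Leibniz signs are
  obtained this way.\<close>

lemma gbar_Grass_part:
  assumes "a \<in> Grass_part L p"
  shows "gbar a = gconst ((-1) ^ p) * a"
proof (rule grassmann_eqI)
  fix S
  show "gcoeff (gbar a) S = gcoeff (gconst ((-1) ^ p) * a) S"
    using Grass_part_gcoeff[OF assms, of S] by (cases "even p"; cases "even (card S)") auto
qed

lemma Grass_0 [simp]: "0 \<in> \<Lambda> L"
  and Grass_add [simp]: "a \<in> \<Lambda> L \<Longrightarrow> b \<in> \<Lambda> L \<Longrightarrow> a + b \<in> \<Lambda> L"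
  and Grass_gconst_mult [simp]: "a \<in> \<Lambda> L \<Longrightarrow> gconst c * a \<in> \<Lambda> L"
  and Grass_of_int_mult [simp]: "a \<in> \<Lambda> L \<Longrightarrow> of_int n * a \<in> \<Lambda> L"
  unfolding Grass_def by (auto, force)

lemma Grass_mult:
  assumes "a \<in> \<Lambda> L" "b \<in> \<Lambda> L"
  shows "a * b \<in> \<Lambda> L"
  unfolding Grass_def
proof safe
  fix S i assume "gcoeff (a * b) S \<noteq> 0" "i \<in> S"
  then obtain T where "T \<in> Pow S" "ext_sign T (S - T) * gcoeff a T * gcoeff b (S - T) \<noteq> 0"
    unfolding gcoeff_mult by (meson sum.not_neutral_contains_not_neutral)
  with assms \<open>i \<in> S\<close> show "enat i < L" unfolding Grass_def by (cases "i \<in> T") auto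
qed

lemma Grass_part_0 [simp]: "0 \<in> Grass_part L p"
  and Grass_part_add [simp]: "a \<in> Grass_part L p \<Longrightarrow> b \<in> Grass_part L p \<Longrightarrow> a + b \<in> Grass_part L p"
  and Grass_part_uminus [simp]: "a \<in> Grass_part L p \<Longrightarrow> - a \<in> Grass_part L p"
  and Grass_part_diff [simp]: "a \<in> Grass_part L p \<Longrightarrow> b \<in> Grass_part L p \<Longrightarrow> a - b \<in> Grass_part L p"
  and Grass_part_gconst_mult [simp]: "a \<in> Grass_part L p \<Longrightarrow> gconst c * a \<in> Grass_part L p"
  and Grass_part_of_int_mult [simp]: "a \<in> Grass_part L p \<Longrightarrow> of_int n * a \<in> Grass_part L p"
  and Grass_part_of_nat_mult [simp]: "a \<in> Grass_part L p \<Longrightarrow> of_nat m * a \<in> Grass_part L p"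
  and Grass_part_1 [simp]: "1 \<in> Grass_part L 0"
  unfolding Grass_part_def Grass_def
  by (auto simp: gcoeff_one split: if_splits) (metis add_0)+

lemma Grass_part_cong: "even p = even q \<Longrightarrow> Grass_part L p = Grass_part L q"
  unfolding Grass_part_def by auto

lemma Grass_part_Suc_Suc [simp]: "Grass_part L (Suc (Suc p)) = Grass_part L p"
  by (rule Grass_part_cong) simp

lemma Grass_part_mult:
  assumes "a \<in> Grass_part L p" "b \<in> Grass_part L q"
  shows "a * b \<in> Grass_part L (p + q)"
  unfolding Grass_part_def
proof (intro CollectI conjI allI impI)
  show "a * b \<in> \<Lambda> L" using assms unfolding Grass_part_def by (auto intro: Grass_mult)
next
  fix S assume nz: "gcoeff (a * b) S \<noteq> 0"
  then obtain T where T: "T \<in> Pow S" "ext_sign T (S - T) * gcoeff a T * gcoeff b (S - T) \<noteq> 0"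
    unfolding gcoeff_mult by (meson sum.not_neutral_contains_not_neutral)
  then have "even (card T) = even p" "even (card (S - T)) = even q"
    using Grass_part_gcoeff assms by force+
  moreover have "finite S" using nz gcoeff_infinite by blast
  then have "card S = card T + card (S - T)"
    using T by (metis PowD card_Diff_subset card_mono finite_subset le_add_diff_inverse)
  ultimately show "even (card S) = even (p + q)" by simp
qed

lemma Grass_part_sum: "(\<And>i. i \<in> I \<Longrightarrow> f i \<in> Grass_part L p) \<Longrightarrow> (\<Sum>i\<in>I. f i) \<in> Grass_part L p"
  by (induction I rule: infinite_finite_induct) auto

lemma Grass_even_mult: "a \<in> \<Lambda>\<^sup>0 L \<Longrightarrow> b \<in> \<Lambda>\<^sup>0 L \<Longrightarrow> a * b \<in> \<Lambda>\<^sup>0 L"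
  using Grass_part_mult[of a L 0 b 0] by simp

lemma Grass_even_power: "a \<in> \<Lambda>\<^sup>0 L \<Longrightarrow> a ^ n \<in> \<Lambda>\<^sup>0 L"
  by (induction n) (auto intro: Grass_even_mult)

lemma gbar_even [simp]: "a \<in> \<Lambda>\<^sup>0 L \<Longrightarrow> gbar a = a"
  and gbar_odd [simp]: "a \<in> \<Lambda>\<^sup>1 L \<Longrightarrow> gbar a = - a"
  by (auto dest: gbar_Grass_part simp: gconst_uminus)

section \<open>Nilpotents, units and square roots\<close>

lemma grassmann_nilpotent:
  assumes "gcoeff a {} = 0"
  obtains N where "a ^ N = 0"
proof -
  define X where "X = \<Union> {S. gcoeff a S \<noteq> 0}"
  have X: "finite X"
    unfolding X_def using finite_gcoeff_support gcoeff_infinite by (intro finite_Union) auto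
  \<comment> \<open>A monomial of \<open>a ^ n\<close> collects at least one new generator from each
    factor, as \<open>a\<close> has no constant term, and all of them lie in the finite set
    \<open>X\<close>.\<close>
  have *: "gcoeff (a ^ n) S \<noteq> 0 \<Longrightarrow> S \<subseteq> X \<and> n \<le> card S" for n S
  proof (induction n arbitrary: S)
    case 0
    then show ?case by (auto simp: gcoeff_one split: if_splits)
  next
    case (Suc n)
    then obtain T where T: "T \<in> Pow S" "ext_sign T (S - T) * gcoeff a T * gcoeff (a ^ n) (S - T) \<noteq> 0"
      unfolding power_Suc gcoeff_mult by (meson sum.not_neutral_contains_not_neutral)
    then have "T \<subseteq> X" "T \<noteq> {}" unfolding X_def using assms by auto
    moreover have "S - T \<subseteq> X" "n \<le> card (S - T)" using Suc.IH[of "S - T"] T by auto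
    moreover have "finite T" using \<open>T \<subseteq> X\<close> X by (rule finite_subset)
    with \<open>T \<noteq> {}\<close> have "0 < card T" by (simp add: card_gt_0_iff)
    ultimately have "S \<subseteq> X" "Suc n \<le> card T + card (S - T)" by auto
    moreover have "card S = card T + card (S - T)"
      using T X \<open>S \<subseteq> X\<close>
      by (metis PowD card_Diff_subset card_mono finite_subset le_add_diff_inverse)
    ultimately show ?case by simp
  qed
  have "a ^ Suc (card X) = 0"
  proof (rule grassmann_eqI)
    fix S
    show "gcoeff (a ^ Suc (card X)) S = gcoeff 0 S"
      using *[of "Suc (card X)" S] card_mono[OF X, of S] by (metis Suc_n_not_le_n gcoeff_zero le_trans)
  qed
  then show thesis by (rule that)
qed

text \<open>The binomial series of 1 + a to the power c, which is exact when
  \<open>a ^ N = 0\<close>. The exponent -1 gives inverses, 1/2 gives square roots.\<close>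

definition binomial_pow :: "complex \<Rightarrow> nat \<Rightarrow> grassmann \<Rightarrow> grassmann" where
  "binomial_pow c N a = (\<Sum>k<N. gconst (c gchoose k) * a ^ k)"

lemma binomial_pow_mult:
  assumes "a ^ N = 0"
  shows "binomial_pow c N a * binomial_pow d N a = binomial_pow (c + d) N a"
proof -
  let ?t = "\<lambda>i j. gconst ((c gchoose i) * (d gchoose j)) * a ^ (i + j)"
  have t: "(gconst (c gchoose i) * a ^ i) * (gconst (d gchoose j) * a ^ j) = ?t i j" for i j
    by (metis gconst_commute gconst_mult mult.assoc power_add)
  have t0: "a ^ (i + j) = 0" if "\<not> i + j < N" for i j
  proof -
    have "a ^ (i + j) = a ^ N * a ^ (i + j - N)" using that by (simp flip: power_add)
    with assms show ?thesis by simp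
  qed
  have "binomial_pow c N a * binomial_pow d N a = (\<Sum>(i, j)\<in>{..<N} \<times> {..<N}. ?t i j)"
    by (simp add: binomial_pow_def sum_product t sum.cartesian_product)
  \<comment> \<open>Nilpotency cuts the square of indices down to a triangle; its diagonals are
    summed by Vandermonde's identity.\<close>
  also have "\<dots> = (\<Sum>(i, j)\<in>{(i, j). i + j < N}. ?t i j)"
    by (rule sum.mono_neutral_right) (auto, metis mult_zero_right t0)
  also have "\<dots> = (\<Sum>k<N. \<Sum>i\<le>k. ?t i (k - i))" by (rule sum.triangle_reindex)
  also have "\<dots> = (\<Sum>k<N. gconst (\<Sum>i\<le>k. (c gchoose i) * (d gchoose (k - i))) * a ^ k)"
  proof (rule sum.cong[OF refl])
    fix k
    have "gconst (\<Sum>i\<in>I. h i) = (\<Sum>i\<in>I. gconst (h i))" for I :: "nat set" and h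
      by (induction I rule: infinite_finite_induct) (auto simp: gconst_add)
    then show "(\<Sum>i\<le>k. ?t i (k - i)) = gconst (\<Sum>i\<le>k. (c gchoose i) * (d gchoose (k - i))) * a ^ k"
      by (simp add: sum_distrib_right)
  qed
  also have "\<dots> = binomial_pow (c + d) N a"
    unfolding binomial_pow_def by (simp add: gbinomial_Vandermonde atMost_atLeast0)
  finally show ?thesis .
qed

lemma binomial_pow_0:
  assumes "a ^ N = 0" shows "binomial_pow 0 N a = 1"
proof -
  have "N > 0" using assms by (cases N) auto
  have "binomial_pow 0 N a = (\<Sum>k<N. if k = 0 then 1 else 0)"
    unfolding binomial_pow_def by (rule sum.cong) (auto simp: gbinomial_0_left)
  with \<open>N > 0\<close> show ?thesis by simp
qed

lemma gbinomial_1_left: "(1::complex) gchoose k = (if k \<in> {0, 1} then 1 else 0)"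
  using binomial_gbinomial[of 1 k, where 'a = complex] by (cases k) (auto simp: binomial_eq_0)

lemma binomial_pow_1:
  assumes "a ^ N = 0" shows "binomial_pow 1 N a = 1 + a"
proof -
  have "binomial_pow 1 N a = (\<Sum>k\<in>{..<N}. if k \<in> {0, 1} then a ^ k else 0)"
    unfolding binomial_pow_def
    by (rule sum.cong) (auto simp: gbinomial_1_left)
  also have "\<dots> = (\<Sum>k\<in>{..<N} \<inter> {0, 1}. a ^ k)"
    by (subst sum.If_cases) (auto intro: sum.cong)
  also have "\<dots> = (\<Sum>k\<in>{0, 1}. a ^ k)"
  proof (rule sum.mono_neutral_left)
    show "\<forall>k\<in>{0, 1} - {..<N} \<inter> {0, 1}. a ^ k = 0"
      using assms by (cases N; cases "N - 1") auto
  qed auto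
  finally show ?thesis by simp
qed

lemma binomial_pow_even: "a \<in> \<Lambda>\<^sup>0 L \<Longrightarrow> binomial_pow c N a \<in> \<Lambda>\<^sup>0 L"
  unfolding binomial_pow_def by (intro Grass_part_sum Grass_part_gconst_mult Grass_even_power)

text \<open>Splits \<open>a\<close> into a nonzero complex number and a unipotent factor. Inverses
  and roots of the former are those of \<complex>, of the latter they are binomial series.\<close>

lemma Grass_even_cases:
  assumes "a \<in> \<Lambda>\<^sup>0 L" "gcoeff a {} \<noteq> 0"
  obtains b N where "b \<in> \<Lambda>\<^sup>0 L" "b ^ N = 0" "a = gconst (gcoeff a {}) * (1 + b)"
proof -
  define b where "b = gconst (1 / gcoeff a {}) * a - 1"
  have "b \<in> \<Lambda>\<^sup>0 L" unfolding b_def using assms by simp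
  moreover have "gcoeff b {} = 0" unfolding b_def using assms by (simp add: gcoeff_one)
  then obtain N where "b ^ N = 0" by (rule grassmann_nilpotent)
  moreover have "a = gconst (gcoeff a {}) * (1 + b)"
    unfolding b_def using assms(2) by (simp flip: gconst_mult mult.assoc)
  ultimately show thesis by (rule that)
qed

lemma Grass_even_inverse:
  assumes "a \<in> \<Lambda>\<^sup>0 L" "gcoeff a {} \<noteq> 0"
  obtains b where "b \<in> \<Lambda>\<^sup>0 L" "a * b = 1"
proof -
  define c where "c = gcoeff a {}"
  obtain b N where b: "b \<in> \<Lambda>\<^sup>0 L" "b ^ N = 0" "a = gconst c * (1 + b)"
    using Grass_even_cases[OF assms] unfolding c_def by blast
  have "(1 + b) * binomial_pow (-1) N b = 1"
    using binomial_pow_mult[OF b(2), of 1 "-1"] binomial_pow_0 binomial_pow_1 b(2) by simp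
  moreover have "a * (gconst (1 / c) * u) = gconst (c * (1 / c)) * ((1 + b) * u)" for u
    by (simp only: b(3) gconst_mult mult.assoc gconst_left_commute[of "1 + b"])
  ultimately have "a * (gconst (1 / c) * binomial_pow (-1) N b) = 1"
    using assms unfolding c_def by simp
  then show thesis by (intro that[of "gconst (1 / c) * binomial_pow (-1) N b"]) (simp_all add: binomial_pow_even b)
qed

lemma Grass_even_sqrt:
  assumes "a \<in> \<Lambda>\<^sup>0 L" "gcoeff a {} \<noteq> 0"
  obtains b where "b \<in> \<Lambda>\<^sup>0 L" "b * b = a"
proof -
  define c where "c = gcoeff a {}"
  obtain b N where b: "b \<in> \<Lambda>\<^sup>0 L" "b ^ N = 0" "a = gconst c * (1 + b)"
    using Grass_even_cases[OF assms] unfolding c_def by blast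
  let ?r = "binomial_pow (1 / 2) N b"
  have "?r * ?r = 1 + b"
    using binomial_pow_mult[OF b(2), of "1/2" "1/2"] binomial_pow_1[OF b(2)] by simp
  moreover have "(gconst d * ?r) * (gconst d * ?r) = gconst (d * d) * (?r * ?r)" for d
    by (simp only: gconst_mult mult.assoc gconst_left_commute[of ?r])
  moreover have "csqrt c * csqrt c = c" by (metis power2_csqrt power2_eq_square)
  ultimately have "(gconst (csqrt c) * ?r) * (gconst (csqrt c) * ?r) = a"
    unfolding b(3) by simp
  then show thesis by (intro that[of "gconst (csqrt c) * ?r"]) (simp_all add: binomial_pow_even b)
qed

lemma gcoeff_mult_empty: "gcoeff (a * b) {} = gcoeff a {} * gcoeff b {}"
  by (simp add: gcoeff_mult)

text \<open>The constant term is multiplicative, hence nonzero on units; conversely, once it is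
  nonzero the remainder is nilpotent and the inverse is a finite series.\<close>

lemma Units_even_monoid:
  "a \<in> Units (even_monoid L) \<longleftrightarrow> a \<in> \<Lambda>\<^sup>0 L \<and> gcoeff a {} \<noteq> 0" (is "_ \<longleftrightarrow> ?R")
proof
  assume "a \<in> Units (even_monoid L)"
  then obtain b where "a \<in> \<Lambda>\<^sup>0 L" "a * b = 1"
    unfolding Units_def even_monoid_def by auto
  then show ?R
    using gcoeff_mult_empty[of a b] by (auto simp: gcoeff_one)
next
  assume ?R
  then obtain b where "b \<in> \<Lambda>\<^sup>0 L" "a * b = 1" using Grass_even_inverse by blast
  moreover have "b * a = 1" using calculation Grass_part_commute[of 0 b L a] by simp
  ultimately show "a \<in> Units (even_monoid L)"
    using \<open>?R\<close> unfolding Units_def even_monoid_def by auto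
qed

text \<open>There are zero divisors, so \<open>(a - b) * (a + b) = 0\<close> does not suffice by
  itself. The constant terms of the two factors cannot both vanish, since they differ by twice that
  of the unit \<open>b\<close>; so one factor is invertible and the other is zero.\<close>

lemma square_eq_Units:
  assumes "a \<in> Units (even_monoid L)" "b \<in> Units (even_monoid L)" "a * a = b * b"
  shows "a = b \<or> a = - b"
proof -
  have ab: "a \<in> \<Lambda>\<^sup>0 L" "b \<in> \<Lambda>\<^sup>0 L" using assms by (auto simp: Units_even_monoid)
  have "a * b = b * a" using Grass_part_commute ab by blast
  with assms(3) have 0: "(a - b) * (a + b) = 0" "(a + b) * (a - b) = 0"
    by (simp_all add: algebra_simps)
  have cancel: "v = 0" if "v * u = 0" "u \<in> \<Lambda>\<^sup>0 L" "gcoeff u {} \<noteq> 0" for u v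
  proof -
    obtain w where "u * w = 1" using Grass_even_inverse \<open>u \<in> _\<close> \<open>gcoeff u {} \<noteq> 0\<close> by blast
    then have "v = v * u * w" by (simp add: mult.assoc)
    with \<open>v * u = 0\<close> show ?thesis by simp
  qed
  have "gcoeff (a + b) {} \<noteq> 0 \<or> gcoeff (a - b) {} \<noteq> 0"
    using assms(2) by (auto simp: Units_even_monoid)
  then show ?thesis
  proof
    assume "gcoeff (a + b) {} \<noteq> 0"
    with cancel[OF 0(1)] ab show ?thesis by simp
  next
    assume "gcoeff (a - b) {} \<noteq> 0"
    with cancel[OF 0(2)] ab have "a + b = 0" by simp
    then show ?thesis by (simp add: eq_neg_iff_add_eq_0)
  qed
qed

section \<open>Superderivations\<close>

lemma superseries_eqI: "(\<And>n. cf0 u n = cf0 v n) \<Longrightarrow> (\<And>n. cf1 u n = cf1 v n) \<Longrightarrow> u = v"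
  by (rule superseries.expand) auto

lemma cf_simps [simp]:
  "cf0 0 n = 0" "cf1 0 n = 0"
  "cf0 (u + v) n = cf0 u n + cf0 v n" "cf1 (u + v) n = cf1 u n + cf1 v n"
  "cf0 (u - v) n = cf0 u n - cf0 v n" "cf1 (u - v) n = cf1 u n - cf1 v n"
  "cf0 (- u) n = - cf0 u n" "cf1 (- u) n = - cf1 u n"
  "cf0 (c *\<^sub>\<Lambda> u) n = c * cf0 u n" "cf1 (c *\<^sub>\<Lambda> u) n = gbar c * cf1 u n"
  "cf0 (z *\<^sub>\<complex> u) n = gconst z * cf0 u n" "cf1 (z *\<^sub>\<complex> u) n = gconst z * cf1 u n"
  "cf0 (xpow k u) n = cf0 u (n - k)" "cf1 (xpow k u) n = cf1 u (n - k)"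
  "cf0 (phi_mult u) n = 0" "cf1 (phi_mult u) = cf0 u"
  "cf0 (ddx u) n = of_int (n + 1) * cf0 u (n + 1)" "cf1 (ddx u) n = of_int (n + 1) * cf1 u (n + 1)"
  "cf0 (ddphi u) = cf1 u" "cf1 (ddphi u) n = 0"
  by (simp_all add: zero_superseries_def plus_superseries_def minus_superseries_def
      uminus_superseries_def smul_def cmul_def xpow_def phi_mult_def ddx_def ddphi_def)

lemma SSeries_iff: "u \<in> SSeries L \<longleftrightarrow> (\<forall>n. cf0 u n \<in> \<Lambda> L \<and> cf1 u n \<in> \<Lambda> L)"
  by (auto simp: SSeries_def series_in_def)

lemma SSeries_part_iff:
  "u \<in> SSeries_part L p \<longleftrightarrow> (\<forall>n. cf0 u n \<in> Grass_part L p \<and> cf1 u n \<in> Grass_part L (Suc p))"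
  by (auto simp: SSeries_part_def series_in_def)

section \<open>Products of doubly infinite series\<close>

definition conv_exists :: "(int \<Rightarrow> grassmann) \<Rightarrow> (int \<Rightarrow> grassmann) \<Rightarrow> bool" where
  "conv_exists f g \<longleftrightarrow> (\<forall>n. finite {k. f k \<noteq> 0 \<and> g (n - k) \<noteq> 0})"

lemma mult_exists_iff:
  "mult_exists u v \<longleftrightarrow> conv_exists (cf0 u) (cf0 v) \<and> conv_exists (cf0 u) (cf1 v) \<and>
     conv_exists (cf1 u) (cf0 v) \<and> conv_exists (cf1 u) (cf1 v)"
  unfolding mult_exists_def conv_exists_def by auto

text \<open>The hypothesis puts the support of \<open>f'\<close> into a translate of the support of
  \<open>f\<close>; this one form serves scalars, powers of x and d/dx.\<close>

lemma conv_exists_left: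
  assumes "conv_exists f g" "\<And>k. f' k \<noteq> 0 \<Longrightarrow> f (k - m) \<noteq> 0"
  shows "conv_exists f' g"
  unfolding conv_exists_def
proof
  fix n
  have "{k. f' k \<noteq> 0 \<and> g (n - k) \<noteq> 0} \<subseteq> (\<lambda>k. k + m) ` {k. f k \<noteq> 0 \<and> g (n - m - k) \<noteq> 0}"
    using assms(2) by (auto intro!: image_eqI[where x = "_ - m"])
  with assms(1) show "finite {k. f' k \<noteq> 0 \<and> g (n - k) \<noteq> 0}"
    unfolding conv_exists_def by (meson finite_imageI finite_subset)
qed

lemma conv_exists_right:
  assumes "conv_exists f g" "\<And>k. g' k \<noteq> 0 \<Longrightarrow> g (k - m) \<noteq> 0"
  shows "conv_exists f g'"
  unfolding conv_exists_def
proof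
  fix n
  have "{k. f k \<noteq> 0 \<and> g' (n - k) \<noteq> 0} \<subseteq> {k. f k \<noteq> 0 \<and> g (n - m - k) \<noteq> 0}"
  proof safe
    fix k assume "g' (n - k) \<noteq> 0" "g (n - m - k) = 0"
    moreover have "n - m - k = n - k - m" by simp
    ultimately show False using assms(2) by metis
  qed
  with assms(1) show "finite {k. f k \<noteq> 0 \<and> g' (n - k) \<noteq> 0}"
    unfolding conv_exists_def by (meson finite_subset)
qed

lemma conv_exists_add_left:
  assumes "conv_exists f h" "conv_exists g h"
  shows "conv_exists (\<lambda>k. f k + g k) h"
  unfolding conv_exists_def
proof
  fix n
  have "{k. f k + g k \<noteq> 0 \<and> h (n - k) \<noteq> 0} \<subseteq>
      {k. f k \<noteq> 0 \<and> h (n - k) \<noteq> 0} \<union> {k. g k \<noteq> 0 \<and> h (n - k) \<noteq> 0}"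
    by auto
  with assms show "finite {k. f k + g k \<noteq> 0 \<and> h (n - k) \<noteq> 0}"
    unfolding conv_exists_def by (meson finite_UnI finite_subset)
qed

lemma conv_exists_add_right:
  assumes "conv_exists h f" "conv_exists h g"
  shows "conv_exists h (\<lambda>k. f k + g k)"
  unfolding conv_exists_def
proof
  fix n
  have "{k. h k \<noteq> 0 \<and> f (n - k) + g (n - k) \<noteq> 0} \<subseteq>
      {k. h k \<noteq> 0 \<and> f (n - k) \<noteq> 0} \<union> {k. h k \<noteq> 0 \<and> g (n - k) \<noteq> 0}"
    by auto
  with assms show "finite {k. h k \<noteq> 0 \<and> f (n - k) + g (n - k) \<noteq> 0}"
    unfolding conv_exists_def by (meson finite_UnI finite_subset)
qed

lemma conv_exists_gbar: "conv_exists f g \<Longrightarrow> conv_exists (\<lambda>k. gbar (f k)) g"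
  by (simp add: conv_exists_def)

lemma conv_exists_zero [simp]: "conv_exists (\<lambda>_. 0) g" "conv_exists f (\<lambda>_. 0)"
  by (simp_all add: conv_exists_def)

text \<open>The index set in \<open>conv\<close> depends on both factors. A common finite superset
  \<open>K\<close> makes several convolutions comparable term by term.\<close>

lemma conv_eq_sum:
  assumes "finite K" "{k. f k \<noteq> 0 \<and> g (n - k) \<noteq> 0} \<subseteq> K"
  shows "conv f g n = (\<Sum>k\<in>K. f k * g (n - k))"
  unfolding conv_def by (rule sum.mono_neutral_left) (use assms in auto)

lemma conv_zero [simp]: "conv (\<lambda>_. 0) g n = 0" "conv f (\<lambda>_. 0) n = 0"
  by (simp_all add: conv_def)

lemma conv_add_left:
  assumes "conv_exists f h" "conv_exists g h"
  shows "conv (\<lambda>k. f k + g k) h n = conv f h n + conv g h n"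
proof -
  let ?K = "{k. f k \<noteq> 0 \<and> h (n - k) \<noteq> 0} \<union> {k. g k \<noteq> 0 \<and> h (n - k) \<noteq> 0}"
  have "finite ?K" using assms by (auto simp: conv_exists_def)
  then show ?thesis
    by (subst (1 2 3) conv_eq_sum[of ?K]) (auto simp: distrib_right sum.distrib)
qed

lemma conv_add_right:
  assumes "conv_exists h f" "conv_exists h g"
  shows "conv h (\<lambda>k. f k + g k) n = conv h f n + conv h g n"
proof -
  let ?K = "{k. h k \<noteq> 0 \<and> f (n - k) \<noteq> 0} \<union> {k. h k \<noteq> 0 \<and> g (n - k) \<noteq> 0}"
  have "finite ?K" using assms by (auto simp: conv_exists_def)
  then show ?thesis
    by (subst (1 2 3) conv_eq_sum[of ?K]) (auto simp: distrib_left sum.distrib)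
qed

lemma conv_scale:
  assumes "conv_exists f g"
  shows "conv (\<lambda>k. gconst c * f k) g n = gconst c * conv f g n"
    and "conv f (\<lambda>k. gconst c * g k) n = gconst c * conv f g n"
proof -
  let ?K = "{k. f k \<noteq> 0 \<and> g (n - k) \<noteq> 0}"
  have "finite ?K" using assms by (auto simp: conv_exists_def)
  note K = conv_eq_sum[OF this]
  show "conv (\<lambda>k. gconst c * f k) g n = gconst c * conv f g n"
    by (subst (1 2) K) (auto simp: sum_distrib_left mult.assoc)
  show "conv f (\<lambda>k. gconst c * g k) n = gconst c * conv f g n"
    by (subst (1 2) K) (auto simp: sum_distrib_left gconst_left_commute)
qed

lemma conv_shift:
  shows "conv (\<lambda>k. f (k - m)) g n = conv f g (n - m)"
    and "conv f (\<lambda>k. g (k - m)) n = conv f g (n - m)"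
proof -
  show "conv (\<lambda>k. f (k - m)) g n = conv f g (n - m)"
    unfolding conv_def
    by (rule sum.reindex_bij_witness[of _ "\<lambda>k. k + m" "\<lambda>k. k - m"]) (auto simp: algebra_simps)
  show "conv f (\<lambda>k. g (k - m)) n = conv f g (n - m)"
    unfolding conv_def by (rule sum.cong) (auto simp: algebra_simps)
qed

text \<open>The Leibniz rule for d/dx: the exponent n + 1 of a product of two terms splits as k + (n
  + 1 - k). The shifts in the derivatives are undone so that all three sums run over the same
  \<open>?K\<close>.\<close>

lemma conv_derivative:
  assumes "conv_exists f g"
  shows "of_int (n + 1) * conv f g (n + 1) =
    conv (\<lambda>k. of_int (k + 1) * f (k + 1)) g n + conv f (\<lambda>k. of_int (k + 1) * g (k + 1)) n"
proof -
  let ?K = "{k. f k \<noteq> 0 \<and> g (n + 1 - k) \<noteq> 0}"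
  have "finite ?K" using assms by (auto simp: conv_exists_def)
  note K = conv_eq_sum[OF this]
  have c: "of_int i * a = a * of_int i" for i and a :: grassmann
    by (simp only: gconst_commute flip: gconst_of_int)
  have "conv (\<lambda>k. of_int (k + 1) * f (k + 1)) g n = conv (\<lambda>k. of_int k * f k) g (n + 1)"
    using conv_shift(1)[of "\<lambda>k. of_int k * f k" "-1" g n] by simp
  moreover have "conv f (\<lambda>k. of_int (k + 1) * g (k + 1)) n = conv f (\<lambda>k. of_int k * g k) (n + 1)"
    using conv_shift(2)[of f "\<lambda>k. of_int k * g k" "-1" n] by simp
  moreover have "of_int (n + 1) * (f k * g (n + 1 - k)) =
      of_int k * f k * g (n + 1 - k) + f k * (of_int (n + 1 - k) * g (n + 1 - k))" for k
  proof -
    have "of_int (n + 1) = of_int k + (of_int (n + 1 - k) :: grassmann)" by (simp flip: of_int_add)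
    then show ?thesis
      by (metis (no_types) c distrib_right mult.assoc)
  qed
  moreover have "conv (\<lambda>k. of_int k * f k) g (n + 1) = (\<Sum>k\<in>?K. of_int k * f k * g (n + 1 - k))"
    by (rule K) auto
  moreover have "conv f (\<lambda>k. of_int k * g k) (n + 1) = (\<Sum>k\<in>?K. f k * (of_int (n + 1 - k) * g (n + 1 - k)))"
    by (rule K) auto
  moreover have "conv f g (n + 1) = (\<Sum>k\<in>?K. f k * g (n + 1 - k))"
    by (rule K) auto
  ultimately show ?thesis
    by (simp only: sum_distrib_left sum.distrib)
qed

lemma cf_ss_mult [simp]:
  "cf0 (ss_mult u v) n = conv (cf0 u) (cf0 v) n"
  "cf1 (ss_mult u v) n = conv (cf1 u) (cf0 v) n + conv (\<lambda>k. gbar (cf0 u k)) (cf1 v) n"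
  by (simp_all add: ss_mult_def)

lemma mult_exists_add:
  "mult_exists u w \<Longrightarrow> mult_exists v w \<Longrightarrow> mult_exists (u + v) w"
  "mult_exists w u \<Longrightarrow> mult_exists w v \<Longrightarrow> mult_exists w (u + v)"
  by (auto simp: mult_exists_iff intro: conv_exists_add_left conv_exists_add_right
      simp flip: fun_eq_iff simp: plus_superseries_def)

lemma mult_exists_transfer:
  assumes "mult_exists u v"
  shows "(\<And>n. cf0 u' n \<noteq> 0 \<Longrightarrow> cf0 u (n - k) \<noteq> 0) \<Longrightarrow> (\<And>n. cf1 u' n \<noteq> 0 \<Longrightarrow> cf1 u (n - k) \<noteq> 0)
      \<Longrightarrow> mult_exists u' v"
    and "(\<And>n. cf0 v' n \<noteq> 0 \<Longrightarrow> cf0 v (n - k) \<noteq> 0) \<Longrightarrow> (\<And>n. cf1 v' n \<noteq> 0 \<Longrightarrow> cf1 v (n - k) \<noteq> 0)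
      \<Longrightarrow> mult_exists u v'"
  using assms unfolding mult_exists_iff by (blast intro: conv_exists_left conv_exists_right)+

lemma mult_exists_cmul:
  assumes "mult_exists u v" shows "mult_exists (c *\<^sub>\<complex> u) v" "mult_exists u (c *\<^sub>\<complex> v)"
  using assms by (auto intro: mult_exists_transfer[where k = 0])

lemma mult_exists_xpow:
  assumes "mult_exists u v" shows "mult_exists (xpow k u) v" "mult_exists u (xpow k v)"
  using assms by (auto intro: mult_exists_transfer[where k = k])

lemma mult_exists_ddx:
  assumes "mult_exists u v" shows "mult_exists (ddx u) v" "mult_exists u (ddx v)"
  using assms by (auto intro: mult_exists_transfer[where k = "-1"])

lemma mult_exists_phi_mult:
  assumes "mult_exists u v" shows "mult_exists (phi_mult u) v" "mult_exists u (phi_mult v)"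
  using assms by (simp_all add: mult_exists_iff phi_mult_def)

lemma mult_exists_ddphi:
  assumes "mult_exists u v" shows "mult_exists (ddphi u) v" "mult_exists u (ddphi v)"
  using assms by (simp_all add: mult_exists_iff ddphi_def)

lemma ss_mult_add:
  "mult_exists u w \<Longrightarrow> mult_exists v w \<Longrightarrow> ss_mult (u + v) w = ss_mult u w + ss_mult v w"
  "mult_exists w u \<Longrightarrow> mult_exists w v \<Longrightarrow> ss_mult w (u + v) = ss_mult w u + ss_mult w v"
  by (rule superseries_eqI;
      simp add: plus_superseries_def gbar_add mult_exists_iff conv_add_left conv_add_right
        conv_exists_gbar algebra_simps)+

lemma ss_mult_cmul:
  assumes "mult_exists u v"
  shows "ss_mult (c *\<^sub>\<complex> u) v = c *\<^sub>\<complex> ss_mult u v" "ss_mult u (c *\<^sub>\<complex> v) = c *\<^sub>\<complex> ss_mult u v"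
  using assms unfolding mult_exists_iff
  by (auto intro!: superseries_eqI
      simp: cmul_def smul_def gbar_mult conv_scale conv_exists_gbar distrib_left)

lemma ss_mult_xpow:
  "ss_mult (xpow k u) v = xpow k (ss_mult u v)" "ss_mult u (xpow k v) = xpow k (ss_mult u v)"
  by (auto intro!: superseries_eqI simp: xpow_def conv_shift conv_shift(1)[of "\<lambda>k. gbar (_ k)"])

lemma ss_mult_phi_mult_left: "ss_mult (phi_mult u) v = phi_mult (ss_mult u v)"
  by (auto intro!: superseries_eqI simp: phi_mult_def)

text \<open>Moving \<phi> to the front past \<open>u\<close> applies \<open>gbar\<close> to the
  coefficients, a sign by homogeneity; the \<phi>-part of \<open>u\<close> drops out because \<phi>
  squares to zero.\<close>

lemma ss_mult_phi_mult_right: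
  assumes "u \<in> SSeries_part L q" "mult_exists u v"
  shows "ss_mult u (phi_mult v) = (-1) ^ q *\<^sub>\<complex> phi_mult (ss_mult u v)"
proof -
  have "(\<lambda>k. gbar (cf0 u k)) = (\<lambda>k. gconst ((-1) ^ q) * cf0 u k)"
    using assms(1) by (auto simp: SSeries_part_iff intro: gbar_Grass_part)
  then show ?thesis
    using assms(2) by (auto intro!: superseries_eqI simp: mult_exists_iff conv_scale phi_mult_def)
qed

lemma cmul_cmul: "c *\<^sub>\<complex> d *\<^sub>\<complex> u = (c * d) *\<^sub>\<complex> u"
  by (rule superseries_eqI) (simp_all add: gconst_mult mult.assoc)

lemma linear_ops:
  "c *\<^sub>\<complex> (u + v) = c *\<^sub>\<complex> u + c *\<^sub>\<complex> v"
  "xpow k (u + v) = xpow k u + xpow k v" "xpow k (c *\<^sub>\<complex> u) = c *\<^sub>\<complex> xpow k u"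
  "phi_mult (u + v) = phi_mult u + phi_mult v" "phi_mult (c *\<^sub>\<complex> u) = c *\<^sub>\<complex> phi_mult u"
  by (rule superseries_eqI; simp add: distrib_left)+

section \<open>Closure properties of superderivations and the four families\<close>

lemma superderivation_add:
  assumes D: "superderivation L p D" and E: "superderivation L p E"
  shows "superderivation L p (\<lambda>u. D u + E u)"
  unfolding superderivation_def
proof (intro conjI allI ballI impI)
  show "super_endo L p (\<lambda>u. D u + E u)"
    using assms unfolding superderivation_def super_endo_def
    by (auto simp: linear_ops image_subset_iff SSeries_iff SSeries_part_iff)
  fix q u v assume u: "u \<in> SSeries_part L q" and v: "v \<in> SSeries L" and uv: "mult_exists u v"
  have ex: "mult_exists (D u) v" "mult_exists u (D v)" "mult_exists (E u) v" "mult_exists u (E v)"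
    using D E u v uv unfolding superderivation_def by blast+
  show "mult_exists (D u + E u) v" "mult_exists u (D v + E v)"
    using ex by (auto intro: mult_exists_add)
  have "D (ss_mult u v) = ss_mult (D u) v + (-1) ^ (p * q) *\<^sub>\<complex> ss_mult u (D v)"
    "E (ss_mult u v) = ss_mult (E u) v + (-1) ^ (p * q) *\<^sub>\<complex> ss_mult u (E v)"
    using D E u v uv unfolding superderivation_def by blast+
  with ex show "D (ss_mult u v) + E (ss_mult u v) =
      ss_mult (D u + E u) v + (-1) ^ (p * q) *\<^sub>\<complex> ss_mult u (D v + E v)"
    by (simp add: ss_mult_add linear_ops)
qed

lemma superderivation_cmul:
  assumes D: "superderivation L p D"
  shows "superderivation L p (\<lambda>u. c *\<^sub>\<complex> D u)"
  unfolding superderivation_def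
proof (intro conjI allI ballI impI)
  show "super_endo L p (\<lambda>u. c *\<^sub>\<complex> D u)"
    using assms unfolding superderivation_def super_endo_def
    by (auto simp: linear_ops image_subset_iff SSeries_iff SSeries_part_iff cmul_cmul mult.commute)
  fix q u v assume u: "u \<in> SSeries_part L q" and v: "v \<in> SSeries L" and uv: "mult_exists u v"
  have ex: "mult_exists (D u) v" "mult_exists u (D v)"
    and eq: "D (ss_mult u v) = ss_mult (D u) v + (-1) ^ (p * q) *\<^sub>\<complex> ss_mult u (D v)"
    using D u v uv unfolding superderivation_def by blast+
  show "mult_exists (c *\<^sub>\<complex> D u) v" "mult_exists u (c *\<^sub>\<complex> D v)"
    using ex by (auto intro: mult_exists_cmul)
  from ex eq show "c *\<^sub>\<complex> D (ss_mult u v) =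
      ss_mult (c *\<^sub>\<complex> D u) v + (-1) ^ (p * q) *\<^sub>\<complex> ss_mult u (c *\<^sub>\<complex> D v)"
    by (simp add: ss_mult_cmul linear_ops cmul_cmul mult.commute)
qed

lemma superderivation_xpow:
  assumes D: "superderivation L p D"
  shows "superderivation L p (\<lambda>u. xpow k (D u))"
  unfolding superderivation_def
proof (intro conjI allI ballI impI)
  show "super_endo L p (\<lambda>u. xpow k (D u))"
    using assms unfolding superderivation_def super_endo_def
    by (auto simp: linear_ops image_subset_iff SSeries_iff SSeries_part_iff)
  fix q u v assume u: "u \<in> SSeries_part L q" and v: "v \<in> SSeries L" and uv: "mult_exists u v"
  have ex: "mult_exists (D u) v" "mult_exists u (D v)"
    and eq: "D (ss_mult u v) = ss_mult (D u) v + (-1) ^ (p * q) *\<^sub>\<complex> ss_mult u (D v)"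
    using D u v uv unfolding superderivation_def by blast+
  show "mult_exists (xpow k (D u)) v" "mult_exists u (xpow k (D v))"
    using ex by (auto intro: mult_exists_xpow)
  from eq show "xpow k (D (ss_mult u v)) =
      ss_mult (xpow k (D u)) v + (-1) ^ (p * q) *\<^sub>\<complex> ss_mult u (xpow k (D v))"
    by (simp add: ss_mult_xpow linear_ops)
qed

text \<open>The sign \<open>(-1) ^ q\<close> from moving \<phi> past \<open>u\<close> is exactly the
  change of the Leibniz sign when the parity goes from \<open>p\<close> to
  \<open>Suc p\<close>.\<close>

lemma superderivation_phi_mult:
  assumes D: "superderivation L p D"
  shows "superderivation L (Suc p) (\<lambda>u. phi_mult (D u))"
  unfolding superderivation_def
proof (intro conjI allI ballI impI)
  show "super_endo L (Suc p) (\<lambda>u. phi_mult (D u))"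
    using assms unfolding superderivation_def super_endo_def
    by (auto simp: linear_ops image_subset_iff SSeries_iff SSeries_part_iff)
  fix q u v assume u: "u \<in> SSeries_part L q" and v: "v \<in> SSeries L" and uv: "mult_exists u v"
  have ex: "mult_exists (D u) v" "mult_exists u (D v)"
    and eq: "D (ss_mult u v) = ss_mult (D u) v + (-1) ^ (p * q) *\<^sub>\<complex> ss_mult u (D v)"
    using D u v uv unfolding superderivation_def by blast+
  show "mult_exists (phi_mult (D u)) v" "mult_exists u (phi_mult (D v))"
    using ex by (auto intro: mult_exists_phi_mult)
  have "(-1 :: complex) ^ q * (-1) ^ q = 1" by (simp flip: power_mult_distrib)
  then have "(-1 :: complex) ^ (Suc p * q) * (-1) ^ q = (-1) ^ (p * q)"
    by (simp add: power_add mult.assoc mult.commute)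
  with eq show "phi_mult (D (ss_mult u v)) =
      ss_mult (phi_mult (D u)) v + (-1) ^ (Suc p * q) *\<^sub>\<complex> ss_mult u (phi_mult (D v))"
    by (simp only: ss_mult_phi_mult_left ss_mult_phi_mult_right[OF u ex(2)] linear_ops cmul_cmul)
qed

lemma Grass_of_int_add_1_mult [simp]:
  "a \<in> \<Lambda> L \<Longrightarrow> (of_int n + 1) * a \<in> \<Lambda> L"
  "a \<in> Grass_part L p \<Longrightarrow> (of_int n + 1) * a \<in> Grass_part L p"
  using Grass_of_int_mult[of a L "n + 1"] Grass_part_of_int_mult[of a L p "n + 1"] by simp_all

lemma superderivation_ddx: "superderivation L 0 ddx"
  unfolding superderivation_def
proof (intro conjI allI ballI impI)
  show "super_endo L 0 ddx"
    unfolding super_endo_def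
    by (auto simp: SSeries_iff SSeries_part_iff distrib_left gconst_left_commute intro!: superseries_eqI)
  fix q u v assume "u \<in> SSeries_part L q" "v \<in> SSeries L" and uv: "mult_exists u v"
  show "mult_exists (ddx u) v" "mult_exists u (ddx v)"
    using uv by (rule mult_exists_ddx)+
  show "ddx (ss_mult u v) = ss_mult (ddx u) v + (-1) ^ (0 * q) *\<^sub>\<complex> ss_mult u (ddx v)"
  proof (rule superseries_eqI)
    fix n
    show "cf0 (ddx (ss_mult u v)) n = cf0 (ss_mult (ddx u) v + (-1) ^ (0 * q) *\<^sub>\<complex> ss_mult u (ddx v)) n"
      using uv conv_derivative[of "cf0 u" "cf0 v" n]
      by (simp add: mult_exists_iff ddx_def)
    show "cf1 (ddx (ss_mult u v)) n = cf1 (ss_mult (ddx u) v + (-1) ^ (0 * q) *\<^sub>\<complex> ss_mult u (ddx v)) n"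
      using uv conv_derivative[of "cf1 u" "cf0 v" n]
        conv_derivative[of "\<lambda>k. gbar (cf0 u k)" "cf1 v" n]
      by (simp add: mult_exists_iff ddx_def conv_exists_gbar gbar_of_int_mult distrib_left
          del: of_int_add)
  qed
qed

lemma superderivation_ddphi: "superderivation L 1 ddphi"
  unfolding superderivation_def
proof (intro conjI allI ballI impI)
  show "super_endo L 1 ddphi"
    unfolding super_endo_def
    by (auto simp: SSeries_iff SSeries_part_iff intro!: superseries_eqI)
  fix q u v assume u: "u \<in> SSeries_part L q" and "v \<in> SSeries L" and uv: "mult_exists u v"
  show "mult_exists (ddphi u) v" "mult_exists u (ddphi v)"
    using uv by (rule mult_exists_ddphi)+
  \<comment> \<open>The two parts of a homogeneous \<open>u\<close> have opposite parities, so their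
    signs are opposite; this makes the \<phi>-parts of the two Leibniz terms cancel.\<close>
  have 0: "(\<lambda>k. gbar (cf0 u k)) = (\<lambda>k. gconst ((-1) ^ q) * cf0 u k)"
    and 1: "(\<lambda>k. gbar (cf1 u k)) = (\<lambda>k. gconst (- ((-1) ^ q)) * cf1 u k)"
    using u gbar_Grass_part[of "cf0 u _" L q] gbar_Grass_part[of "cf1 u _" L "Suc q"]
    by (auto simp: SSeries_part_iff)
  show "ddphi (ss_mult u v) = ss_mult (ddphi u) v + (-1) ^ (1 * q) *\<^sub>\<complex> ss_mult u (ddphi v)"
    using uv
    by (intro superseries_eqI)
      (simp_all add: mult_exists_iff 0 1 conv_scale, simp_all add: ddphi_def gconst_uminus 1 conv_scale)
qed

text \<open>The operator \<phi> d/d\<phi> is built with parity 2, but grading and Leibniz sign see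
  parities mod 2 only, so it counts as even.\<close>

lemma superderivation_parity:
  assumes "superderivation L p D" "even p = even p'"
  shows "superderivation L p' D"
proof -
  have "SSeries_part L (p + q) = SSeries_part L (p' + q)" for q
    using assms(2) Grass_part_cong[of "p + q" "p' + q" L] Grass_part_cong[of "Suc (p + q)" "Suc (p' + q)" L]
    by (simp add: SSeries_part_def)
  moreover have "(-1 :: complex) ^ (p * q) = (-1) ^ (p' * q)" for q
    using assms(2) by (cases "even q"; cases "even p"; simp)
  ultimately show ?thesis using assms(1) unfolding superderivation_def super_endo_def by simp
qed

lemma superderivation_Lop: "superderivation L 0 (Lop n)"
proof -
  have *: "Lop n = (\<lambda>u. (-1) *\<^sub>\<complex> (xpow (n + 1) (ddx u) + (of_int (n + 1) / 2) *\<^sub>\<complex> xpow n (phi_mult (ddphi u))))"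
    unfolding Lop_def by (intro ext superseries_eqI) (simp_all add: gconst_uminus)
  have "superderivation L 0 (\<lambda>u. phi_mult (ddphi u))"
    by (rule superderivation_parity[OF superderivation_phi_mult[OF superderivation_ddphi]]) simp
  then show ?thesis unfolding *
    by (intro superderivation_cmul superderivation_add superderivation_xpow superderivation_ddx)
qed

lemma superderivation_Jop: "superderivation L 0 (Jop n)"
proof -
  have "superderivation L 0 (\<lambda>u. phi_mult (ddphi u))"
    by (rule superderivation_parity[OF superderivation_phi_mult[OF superderivation_ddphi]]) simp
  then show ?thesis unfolding Jop_def[abs_def] by (rule superderivation_xpow)
qed

lemma superderivation_Gop: "superderivation L 1 (Gop j n)"
  unfolding Gop_def[abs_def]
  using superderivation_phi_mult[OF superderivation_ddx, of L]
  by (intro superderivation_cmul superderivation_xpow superderivation_add superderivation_ddphi) simp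

text \<open>Each relation is compared coefficient by coefficient. Since the operators involve only
  complex scalars, shifts and exchanges of the two parts, what remains is arithmetic in
  \<complex>.\<close>

lemma NS2_representation_ops: "NS2_representation L 0 Lop Jop Gop"
  unfolding NS2_representation_def
proof (intro conjI allI ballI)
  fix n
  show "super_endo L 0 (Lop n)" "super_endo L 0 (Jop n)" "super_endo L 1 (Gop 1 n)" "super_endo L 1 (Gop 2 n)"
    using superderivation_Lop superderivation_Jop superderivation_Gop
    unfolding superderivation_def by blast+
next
  fix m n u
  note defs = Lop_def Jop_def Gop_def
  have 1: "Lop m (Lop n u) - Lop n (Lop m u) = of_int (m - n) *\<^sub>\<complex> Lop (m + n) u"
    by (rule superseries_eqI; rule grassmann_eqI; simp add: defs add_ac diff_diff_eq; simp add: field_simps)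
  have 2: "Jop m (Jop n u) - Jop n (Jop m u) = 0"
    by (rule superseries_eqI; rule grassmann_eqI; simp add: defs algebra_simps)
  have 3: "Lop m (Jop n u) - Jop n (Lop m u) = of_int (- n) *\<^sub>\<complex> Jop (m + n) u"
    by (rule superseries_eqI; rule grassmann_eqI; simp add: defs add_ac diff_diff_eq; simp add: field_simps)
  have 4: "Lop m (Gop j (n + 1) u) - Gop j (n + 1) (Lop m u) =
     (of_int m / 2 - of_int n - 1 / 2) *\<^sub>\<complex> Gop j (m + n + 1) u" for j
    by (rule superseries_eqI; rule grassmann_eqI; simp add: defs add_ac diff_diff_eq; simp add: field_simps)
  have 5: "Jop m (Gop 1 (n + 1) u) - Gop 1 (n + 1) (Jop m u) = (- \<i>) *\<^sub>\<complex> Gop 2 (m + n + 1) u"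
    by (rule superseries_eqI; rule grassmann_eqI; simp add: defs add_ac diff_diff_eq power3_eq_cube eval_nat_numeral; simp add: field_simps)
  have 6: "Jop m (Gop 2 (n + 1) u) - Gop 2 (n + 1) (Jop m u) = \<i> *\<^sub>\<complex> Gop 1 (m + n + 1) u"
    by (rule superseries_eqI; rule grassmann_eqI; simp add: defs add_ac diff_diff_eq power3_eq_cube eval_nat_numeral; simp add: field_simps)
  have 7: "Gop j (m + 1) (Gop j n u) + Gop j n (Gop j (m + 1) u) = 2 *\<^sub>\<complex> Lop (m + n) u" if "j \<in> {1, 2}" for j
    using that
    by (elim insertE emptyE; intro superseries_eqI; intro grassmann_eqI; simp add: defs add_ac diff_diff_eq power3_eq_cube eval_nat_numeral; simp add: field_simps)
  have 8: "Gop 1 (m + 1) (Gop 2 n u) + Gop 2 n (Gop 1 (m + 1) u) = (- \<i> * of_int (m - n + 1)) *\<^sub>\<complex> Jop (m + n) u"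
    by (rule superseries_eqI; rule grassmann_eqI; simp add: defs add_ac diff_diff_eq power3_eq_cube eval_nat_numeral; simp add: field_simps)
  have "0 *\<^sub>\<complex> u = 0" by (rule superseries_eqI) simp_all
  then show "let comm = \<lambda>D E. D (E u) - E (D u); anticomm = \<lambda>D E. D (E u) + E (D u);
            \<delta> = (if m + n = 0 then 1 else 0) in
        comm (Lop m) (Lop n) = of_int (m - n) *\<^sub>\<complex> Lop (m + n) u
            + (of_int (m ^ 3 - m) / 12 * \<delta> * 0) *\<^sub>\<complex> u \<and>
        comm (Jop m) (Jop n) = (of_int m / 3 * \<delta> * 0) *\<^sub>\<complex> u \<and>
        comm (Lop m) (Jop n) = of_int (- n) *\<^sub>\<complex> Jop (m + n) u \<and>
        (\<forall>j \<in> {1, 2}. comm (Lop m) (Gop j (n + 1)) =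
            (of_int m / 2 - of_int n - 1 / 2) *\<^sub>\<complex> Gop j (m + n + 1) u) \<and>
        comm (Jop m) (Gop 1 (n + 1)) = (- \<i>) *\<^sub>\<complex> Gop 2 (m + n + 1) u \<and>
        comm (Jop m) (Gop 2 (n + 1)) = \<i> *\<^sub>\<complex> Gop 1 (m + n + 1) u \<and>
        (\<forall>j \<in> {1, 2}. anticomm (Gop j (m + 1)) (Gop j n) =
            2 *\<^sub>\<complex> Lop (m + n) u + (of_int (m ^ 2 + m) / 3 * \<delta> * 0) *\<^sub>\<complex> u) \<and>
        anticomm (Gop 1 (m + 1)) (Gop 2 n) = (- \<i> * of_int (m - n + 1)) *\<^sub>\<complex> Jop (m + n) u"
    using 1 2 3 4 5 6 7 8 unfolding Let_def by (simp only: mult_zero_right add_0_right) blast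
qed

section \<open>Exponentials of triangular operators\<close>

text \<open>Interleaving the coefficients of x^m and \<phi> x^m into one sequence turns
  triangularity and parity into statements about natural numbers.\<close>

definition weight_series :: "(nat \<Rightarrow> grassmann) \<Rightarrow> superseries" where
  "weight_series c = Superseries (\<lambda>n. if n < 0 then 0 else c (2 * nat n)) (\<lambda>n. if n < 0 then 0 else c (2 * nat n + 1))"

lemma cf_weight_series [simp]:
  "cf0 (weight_series c) n = (if n < 0 then 0 else c (2 * nat n))"
  "cf1 (weight_series c) n = (if n < 0 then 0 else c (2 * nat n + 1))"
  by (simp_all add: weight_series_def)

lemma weight_series_eq_iff: "weight_series c = weight_series d \<longleftrightarrow> c = d"
proof
  assume eq: "weight_series c = weight_series d"
  show "c = d"
  proof
    fix w
    show "c w = d w"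
    proof (cases "even w")
      case True
      then show ?thesis using arg_cong[OF eq, of "\<lambda>u. cf0 u (int (w div 2))"] by simp
    next
      case False
      then show ?thesis using arg_cong[OF eq, of "\<lambda>u. cf1 u (int (w div 2))"] by simp
    qed
  qed
qed simp

lemma eq_weight_series:
  assumes "\<And>n. n < 0 \<Longrightarrow> cf0 u n = 0" "\<And>n. n < 0 \<Longrightarrow> cf1 u n = 0"
  shows "u = weight_series (\<lambda>w. if even w then cf0 u (int (w div 2)) else cf1 u (int (w div 2)))"
  by (rule superseries_eqI) (use assms in auto)

text \<open>Local finiteness: \<open>J w\<close> contains every index that contributes in weight
  \<open>w\<close>. This replaces the index sets of \<open>fsum\<close>, which depend on the
  summands, by fixed finite ones.\<close>

lemma fsum_weight_series:
  assumes u: "\<And>i. i \<in> I \<Longrightarrow> u i = weight_series (d i)"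
    and fin: "\<And>w. finite (J w)" "\<And>w. J w \<subseteq> I" "\<And>i w. i \<in> I \<Longrightarrow> i \<notin> J w \<Longrightarrow> d i w = 0"
  shows "fsummable I u" "fsum I u = weight_series (\<lambda>w. \<Sum>i\<in>J w. d i w)"
proof -
  have sub: "{i \<in> I. d i w \<noteq> 0} \<subseteq> J w" for w using fin(3) by blast
  then have f: "finite {i \<in> I. d i w \<noteq> 0}" for w using fin(1) by (meson finite_subset)
  have s0: "{i \<in> I. cf0 (u i) n \<noteq> 0} = (if n < 0 then {} else {i \<in> I. d i (2 * nat n) \<noteq> 0})"
    and s1: "{i \<in> I. cf1 (u i) n \<noteq> 0} = (if n < 0 then {} else {i \<in> I. d i (2 * nat n + 1) \<noteq> 0})" for n
    using u by (auto split: if_splits)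
  show "fsummable I u"
    unfolding fsummable_def s0 s1 using f by auto
  have sm: "(\<Sum>i\<in>J w. d i w) = (\<Sum>i\<in>{i \<in> I. d i w \<noteq> 0}. d i w)" for w
    using fin sub by (intro sum.mono_neutral_right) auto
  show "fsum I u = weight_series (\<lambda>w. \<Sum>i\<in>J w. d i w)"
    unfolding sm fsum_def s0 s1 by (rule superseries_eqI) (auto simp: u intro!: sum.cong)
qed

text \<open>
  \<open>mat_coeff z k j\<close> is the coefficient with which the exponent maps weight \<open>j\<close> to weight \<open>j + k\<close>,
  normalised so that \<open>z k\<close> consists of its values at \<open>j = 1\<close> and \<open>j = 2\<close>, that is, of the
  coefficients that arise from \<open>\<phi>\<close> and from \<open>x\<close>.
\<close>

definition mat_coeff :: "(nat \<Rightarrow> grassmann \<times> grassmann) \<Rightarrow> nat \<Rightarrow> nat \<Rightarrow> grassmann" where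
  "mat_coeff z k j = (if odd j then fst (z k) else 0) + (if odd j \<and> odd k then 0 else of_nat (j div 2) * snd (z k))"

lemma mat_coeff_1 [simp]: "mat_coeff z k (Suc 0) = fst (z k)" and mat_coeff_2 [simp]: "mat_coeff z k 2 = snd (z k)"
  by (simp_all add: mat_coeff_def)

definition step :: "(nat \<Rightarrow> grassmann \<times> grassmann) \<Rightarrow> (nat \<Rightarrow> grassmann) \<Rightarrow> nat \<Rightarrow> grassmann" where
  "step z c w = (\<Sum>k=1..w. mat_coeff z k (w - k) * c (w - k))"

text \<open>The series may stop at \<open>k = w\<close> because each application of
  \<open>step\<close> raises the weight by at least one.\<close>

definition exp_step :: "(nat \<Rightarrow> grassmann \<times> grassmann) \<Rightarrow> (nat \<Rightarrow> grassmann) \<Rightarrow> nat \<Rightarrow> grassmann" where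
  "exp_step z c w = (\<Sum>k\<le>w. gconst (1 / fact k) * (step z ^^ k) c w)"

text \<open>The coefficients that \<phi> and x acquire at level \<open>k\<close>. For k = 2n they
  come from L and J, for k = 2n - 1 from the two G, whose prefactors (-i)^(j+1) are -1 and i and
  lead to M1 - i M2 and M1 + i M2. Level 0 is \<open>undefined\<close> to fit extensional function
  spaces.\<close>

definition field_coeffs :: "gseq \<times> gseq \<times> gseq \<times> gseq \<Rightarrow> nat \<Rightarrow> grassmann \<times> grassmann" where
  "field_coeffs = (\<lambda>(A1, A2, M1, M2). \<lambda>k\<in>{1..}. let n = Suc k div 2 in
     if even k then (gconst (of_nat (n + 1) / 2) * A1 n - A2 n, A1 n)
     else (M1 n - gconst \<i> * M2 n, M1 n + gconst \<i> * M2 n))"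

lemma gcoeff_mult_scalars:
  "gcoeff (a * (gconst x * b)) S = x * gcoeff (a * b) S"
  "gcoeff (gconst x * a * b) S = x * gcoeff (a * b) S"
  "gcoeff (a * (of_int i * b)) S = of_int i * gcoeff (a * b) S"
  "gcoeff (a * (of_nat n * b)) S = of_nat n * gcoeff (a * b) S"
  "gcoeff (of_nat n * a * b) S = of_nat n * gcoeff (a * b) S"
  by (simp_all add: gconst_left_commute mult.assoc flip: gconst_of_int gconst_of_nat)

text \<open>Parities enter through \<open>gbar\<close>: an odd parameter acts on \<phi>-parts with
  the opposite sign, and together with the signs in G this gives left multiplication by
  \<open>mat_coeff\<close> in all weights.\<close>

lemma terms_zero_weight_series:
  assumes "n \<ge> 1" "A1 n \<in> \<Lambda>\<^sup>0 L" "A2 n \<in> \<Lambda>\<^sup>0 L" "M1 n \<in> \<Lambda>\<^sup>1 L" "M2 n \<in> \<Lambda>\<^sup>1 L"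
  defines "z \<equiv> field_coeffs (A1, A2, M1, M2)"
  shows "terms_zero A1 A2 M1 M2 n (weight_series c) = weight_series (\<lambda>w.
    (if 2 * n \<le> w then mat_coeff z (2 * n) (w - 2 * n) * c (w - 2 * n) else 0) +
    (if 2 * n - 1 \<le> w then mat_coeff z (2 * n - 1) (w - (2 * n - 1)) * c (w - (2 * n - 1)) else 0))"
    (is "?l = weight_series ?r")
proof -
  have "Suc (2 * n) div 2 = n" "Suc (2 * n - 1) div 2 = n" "odd (2 * n - 1)" "2 * n - 1 \<ge> 1"
    using assms(1) by auto
  then have z: "fst (z (2 * n)) = gconst (of_nat (n + 1) / 2) * A1 n - A2 n" "snd (z (2 * n)) = A1 n"
    "fst (z (2 * n - 1)) = M1 n - gconst \<i> * M2 n" "snd (z (2 * n - 1)) = M1 n + gconst \<i> * M2 n"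
    using assms(1) unfolding z_def field_coeffs_def by (simp_all add: Let_def)
  have mat_coeff: "mat_coeff z (2 * n) (2 * k) = of_nat k * A1 n"
    "mat_coeff z (2 * n) (2 * k + 1) = gconst (of_nat (n + 1) / 2) * A1 n - A2 n + of_nat k * A1 n"
    "mat_coeff z (2 * n - 1) (2 * k + 1) = M1 n - gconst \<i> * M2 n"
    "mat_coeff z (2 * n - 1) (2 * k) = of_nat k * (M1 n + gconst \<i> * M2 n)" for k
    using \<open>odd (2 * n - 1)\<close> unfolding mat_coeff_def z by simp_all
  have gb: "gbar (A1 n) = A1 n" "gbar (A2 n) = A2 n" "gbar (M1 n) = - M1 n" "gbar (M2 n) = - M2 n"
    using assms by auto
  have neg: "m < 0 \<Longrightarrow> cf0 ?l m = 0" "m < 0 \<Longrightarrow> cf1 ?l m = 0" for m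
    using assms(1) by (auto simp: terms_zero_def Lop_def Jop_def Gop_def)
  have 0: "cf0 ?l (int m) = ?r (2 * m)" for m
  proof (cases "n \<le> m")
    case True
    then obtain k where k: "m = n + k" using le_Suc_ex by blast
    have "2 * (n + k) - (2 * n - 1) = 2 * k + 1" "2 * (n + k) - 2 * n = 2 * k"
      "2 * n - 1 \<le> 2 * (n + k)" using assms(1) by auto
    then have "?r (2 * m) = mat_coeff z (2 * n) (2 * k) * c (2 * k) + mat_coeff z (2 * n - 1) (2 * k + 1) * c (2 * k + 1)"
      unfolding k by simp
    also have "\<dots> = cf0 ?l (int m)"
      unfolding k mat_coeff using assms(1)
      by (intro grassmann_eqI) (simp add: terms_zero_def Lop_def Jop_def Gop_def
          gcoeff_mult_scalars distrib_left distrib_right left_diff_distrib right_diff_distrib nat_mult_distrib; simp add: algebra_simps power3_eq_cube)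
    finally show ?thesis by simp
  next
    case False
    then have "\<not> 2 * n \<le> 2 * m" "\<not> 2 * n - 1 \<le> 2 * m" by linarith+
    with False show ?thesis by (simp add: terms_zero_def Lop_def Jop_def Gop_def)
  qed
  have 1: "cf1 ?l (int m) = ?r (2 * m + 1)" for m
  proof (cases "n \<le> m + 1")
    case True
    then obtain k where k: "m + 1 = n + k" using le_Suc_ex by blast
    \<comment> \<open>In the boundary case \<open>k = 0\<close> the even level does not reach weight
      \<open>2 * m + 1\<close>; the odd level starts from weight 0, where its entry has the factor 0
      because d/dx kills constants.\<close>
    have r: "?r (2 * m + 1) = (if k = 0 then 0 else mat_coeff z (2 * n) (2 * k - 1) * c (2 * k - 1)) + mat_coeff z (2 * n - 1) (2 * k) * c (2 * k)"
    proof -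
      have "2 * m + 1 - 2 * n = 2 * k - 1" "2 * m + 1 - (2 * n - 1) = 2 * k"
        "2 * n \<le> 2 * m + 1 \<longleftrightarrow> k \<noteq> 0" "2 * n - 1 \<le> 2 * m + 1"
        using k assms(1) by arith+
      then show ?thesis by simp
    qed
    have i: "int m = int n + int k - 1" using k by linarith
    show ?thesis
    proof (cases k)
      case 0
      with r i show ?thesis using assms(1)
        by (simp add: mat_coeff_def terms_zero_def Lop_def Jop_def Gop_def)
    next
      case (Suc j)
      have "2 * k - 1 = 2 * j + 1" using Suc by simp
      with r have r: "?r (2 * m + 1) = mat_coeff z (2 * n) (2 * j + 1) * c (2 * j + 1) + mat_coeff z (2 * n - 1) (2 * k) * c (2 * k)"
        using Suc by simp
      show ?thesis unfolding r i mat_coeff unfolding Suc using assms(1)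
        by (intro grassmann_eqI) (simp add: terms_zero_def Lop_def Jop_def Gop_def gb gbar_mult
          gcoeff_mult_scalars distrib_left distrib_right left_diff_distrib right_diff_distrib nat_mult_distrib nat_add_distrib; simp add: algebra_simps power3_eq_cube)
    qed
  next
    case False
    then have "\<not> 2 * n \<le> 2 * m + 1" "\<not> 2 * n - 1 \<le> 2 * m + 1" by linarith+
    with False show ?thesis by (simp add: terms_zero_def Lop_def Jop_def Gop_def)
  qed
  show ?thesis
    by (rule superseries_eqI) (use neg 0 1 in \<open>auto simp: not_less elim!: nonneg_int_cases\<close>)
qed

lemma sum_even_odd: "(\<Sum>n=1..N. g (2 * n) + g (2 * n - 1)) = (\<Sum>k=1..2 * N. g k)" for g :: "nat \<Rightarrow> 'a :: comm_monoid_add"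
proof (induction N)
  case (Suc N)
  have "2 * Suc N = Suc (Suc (2 * N))" by simp
  with Suc show ?case by (simp add: add_ac)
qed simp

definition param_seqs :: "enat \<Rightarrow> (gseq \<times> gseq \<times> gseq \<times> gseq) set" where
  "param_seqs L = even_seqs L \<times> even_seqs L \<times> odd_seqs L \<times> odd_seqs L"

lemma
  assumes "(A1, A2, M1, M2) \<in> param_seqs L"
  defines "z \<equiv> field_coeffs (A1, A2, M1, M2)"
  shows fsummable_terms_zero: "fsummable {1..} (\<lambda>n. terms_zero A1 A2 M1 M2 n (weight_series c))"
    and fsum_terms_zero: "fsum {1..} (\<lambda>n. terms_zero A1 A2 M1 M2 n (weight_series c)) = weight_series (step z c)"
proof -
  define g where "g w k = (if k \<le> w then mat_coeff z k (w - k) * c (w - k) else 0)" for w k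
  have u: "terms_zero A1 A2 M1 M2 n (weight_series c) = weight_series (\<lambda>w. g w (2 * n) + g w (2 * n - 1))" if "n \<in> {1..}" for n
    unfolding g_def z_def using assms(1) that
    by (intro terms_zero_weight_series[of n A1 L A2 M1 M2 c]) (auto simp: param_seqs_def even_seqs_def odd_seqs_def PiE_iff)
  \<comment> \<open>For \<open>n > Suc w\<close> both levels of the n-th term, \<open>2 * n\<close>
    and \<open>2 * n - 1\<close>, exceed \<open>w\<close>.\<close>
  have 0: "g w (2 * n) + g w (2 * n - 1) = 0" if "n \<notin> {1..Suc w}" "n \<in> {1..}" for n w
    using that unfolding g_def by auto
  note F = fsum_weight_series[of "{1..}", OF u, where J = "\<lambda>w. {1..Suc w}", OF _ _ _ 0]
  show "fsummable {1..} (\<lambda>n. terms_zero A1 A2 M1 M2 n (weight_series c))"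
    by (rule F) auto
  have "(\<Sum>n = 1..Suc w. g w (2 * n) + g w (2 * n - 1)) = step z c w" for w
  proof -
    have "(\<Sum>n = 1..Suc w. g w (2 * n) + g w (2 * n - 1)) = (\<Sum>k = 1..2 * Suc w. g w k)"
      by (rule sum_even_odd)
    also have "\<dots> = (\<Sum>k = 1..w. g w k)"
      by (rule sum.mono_neutral_right) (auto simp: g_def)
    also have "\<dots> = step z c w"
      unfolding step_def by (rule sum.cong) (auto simp: g_def)
    finally show ?thesis .
  qed
  moreover have "fsum {1..} (\<lambda>n. terms_zero A1 A2 M1 M2 n (weight_series c)) = weight_series (\<lambda>w. \<Sum>n = 1..Suc w. g w (2 * n) + g w (2 * n - 1))"
    by (rule F) auto
  ultimately show "fsum {1..} (\<lambda>n. terms_zero A1 A2 M1 M2 n (weight_series c)) = weight_series (step z c)" by simp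
qed

lemma funpow_step_lt:
  assumes "\<And>w. w < w0 \<Longrightarrow> c w = 0" "w < w0 + k"
  shows "(step z ^^ k) c w = 0"
  using assms(2)
proof (induction k arbitrary: w)
  case (Suc k)
  have "mat_coeff z i (w - i) * (step z ^^ k) c (w - i) = 0" if "i \<in> {1..w}" for i
    using that Suc.prems by (subst Suc.IH) auto
  then show ?case unfolding funpow.simps comp_def step_def[of z "(step z ^^ k) c"] by (rule sum.neutral[OF ballI])
qed (use assms in auto)

lemma
  assumes "(A1, A2, M1, M2) \<in> param_seqs L"
  defines "z \<equiv> field_coeffs (A1, A2, M1, M2)"
  shows exp_sum_exists_terms_zero: "exp_sum_exists (terms_zero A1 A2 M1 M2) (weight_series c)"
    and exp_sum_terms_zero: "exp_sum (terms_zero A1 A2 M1 M2) (weight_series c) = weight_series (exp_step z c)"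
proof -
  define T where "T = (\<lambda>w. fsum {1..} (\<lambda>n. terms_zero A1 A2 M1 M2 n w))"
  have T: "(T ^^ k) (weight_series c) = weight_series ((step z ^^ k) c)" for k
  proof (induction k)
    case (Suc k)
    then have "(T ^^ Suc k) (weight_series c) = T (weight_series ((step z ^^ k) c))" by simp
    then show ?case by (simp add: T_def fsum_terms_zero[OF assms(1), folded z_def] del: One_nat_def)
  qed simp
  have u: "(1 / fact k) *\<^sub>\<complex> (T ^^ k) (weight_series c) = weight_series (\<lambda>w. gconst (1 / fact k) * (step z ^^ k) c w)" for k :: nat
    unfolding T by (rule superseries_eqI) auto
  have 0: "gconst (1 / fact k) * (step z ^^ k) c w = 0" if "k \<notin> {..w}" for k w
    using that by (subst funpow_step_lt[of 0]) auto
  note F = fsum_weight_series[of UNIV, OF u, where J = "\<lambda>w. {..w}", OF _ _ 0]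
  have "fsummable UNIV (\<lambda>k::nat. (1 / fact k) *\<^sub>\<complex> (T ^^ k) (weight_series c))"
    by (rule F) auto
  moreover have "fsummable {1..} (\<lambda>n. terms_zero A1 A2 M1 M2 n ((T ^^ k) (weight_series c)))" for k
    unfolding T by (rule fsummable_terms_zero[OF assms(1)])
  ultimately show "exp_sum_exists (terms_zero A1 A2 M1 M2) (weight_series c)"
    unfolding exp_sum_exists_def T_def Let_def by blast
  show "exp_sum (terms_zero A1 A2 M1 M2) (weight_series c) = weight_series (exp_step z c)"
    unfolding exp_sum_def exp_op_def T_def[symmetric] exp_step_def[abs_def] by (rule F) auto
qed

section \<open>Exponentials of a single leading term\<close>

definition single :: "nat \<Rightarrow> grassmann \<Rightarrow> nat \<Rightarrow> grassmann" where
  "single w0 a w = (if w = w0 then a else 0)"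

lemma funpow_step_single_lt: "w < w0 + k \<Longrightarrow> (step z ^^ k) (single w0 a) w = 0"
  by (rule funpow_step_lt[of w0]) (auto simp: single_def)

text \<open>An entry of level \<open>i\<close> has parity \<open>i\<close> and shifts the weight by
  \<open>i\<close>, so the parity of a coefficient is its distance from \<open>w0\<close>; mod 2
  this is \<open>w + w0\<close>.\<close>

lemma funpow_step_single_parity:
  assumes "\<And>k. k \<ge> 1 \<Longrightarrow> z k \<in> Grass_part L k \<times> Grass_part L k" "a \<in> \<Lambda>\<^sup>0 L"
  shows "(step z ^^ k) (single w0 a) w \<in> Grass_part L (w + w0)"
proof (induction k arbitrary: w)
  case 0
  show ?case using assms(2) Grass_part_cong[of "w0 + w0" 0 L] by (auto simp: single_def)
next
  case (Suc k)
  have "mat_coeff z i (w - i) * (step z ^^ k) (single w0 a) (w - i) \<in> Grass_part L (w + w0)" if "i \<in> {1..w}" for i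
  proof -
    have "z i \<in> Grass_part L i \<times> Grass_part L i" using assms(1) that by simp
    then have "mat_coeff z i (w - i) \<in> Grass_part L i"
      unfolding mat_coeff_def by (cases "z i") auto
    from Grass_part_mult[OF this Suc.IH[of "w - i"]] that show ?thesis by simp
  qed
  then show ?case unfolding funpow.simps comp_def step_def[of z "(step z ^^ k) (single w0 a)"]
    by (rule Grass_part_sum)
qed

lemma mat_coeff_cong: "z k = z' k \<Longrightarrow> mat_coeff z k j = mat_coeff z' k j"
  by (simp add: mat_coeff_def)

text \<open>A path of upward jumps from \<open>w0\<close> to a weight at most \<open>w0 + m\<close>
  contains no jump longer than \<open>m\<close>.\<close>

lemma funpow_step_single_cong:
  assumes "\<And>j. 1 \<le> j \<Longrightarrow> j \<le> m \<Longrightarrow> z j = z' j" "w \<le> w0 + m"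
  shows "(step z ^^ k) (single w0 a) w = (step z' ^^ k) (single w0 a) w"
  using assms(2)
proof (induction k arbitrary: w)
  case (Suc k)
  have "mat_coeff z i (w - i) * (step z ^^ k) (single w0 a) (w - i) =
      mat_coeff z' i (w - i) * (step z' ^^ k) (single w0 a) (w - i)" if "i \<in> {1..w}" for i
  proof (cases "w - i < w0")
    case True
    then show ?thesis using funpow_step_single_lt[of "w - i" w0 k] by simp
  next
    case False
    with that Suc.prems have "i \<le> m" by auto
    with that Suc.prems assms(1)[of i] show ?thesis by (auto simp: Suc.IH intro: arg_cong2 mat_coeff_cong)
  qed
  then show ?case
    unfolding funpow.simps comp_def step_def[of z "(step z ^^ k) (single w0 a)"]
      step_def[of z' "(step z' ^^ k) (single w0 a)"] by (rule sum.cong[OF refl])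
qed simp

text \<open>The contributions to the coefficient \<open>l\<close> above the leading one that are of
  order two or more in the exponent.\<close>

definition higher_terms :: "nat \<Rightarrow> grassmann \<Rightarrow> nat \<Rightarrow> (nat \<Rightarrow> grassmann \<times> grassmann) \<Rightarrow> grassmann" where
  "higher_terms w0 a l z = (\<Sum>k=2..w0 + l. gconst (1 / fact k) * (step z ^^ k) (single w0 a) (w0 + l))"

text \<open>Two or more positive jumps with sum \<open>l\<close> are each shorter than
  \<open>l\<close>. This makes the equations for the parameters recursive.\<close>

lemma higher_terms_cong:
  assumes "\<And>j. 1 \<le> j \<Longrightarrow> j < l \<Longrightarrow> z j = z' j"
  shows "higher_terms w0 a l z = higher_terms w0 a l z'"
proof -
  have "(step z ^^ k) (single w0 a) (w0 + l) = (step z' ^^ k) (single w0 a) (w0 + l)" if k: "k \<ge> 2" for k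
  proof -
    obtain k' where k': "k = Suc k'" "k' \<ge> 1" using k by (cases k) auto
    have "mat_coeff z i (w0 + l - i) * (step z ^^ k') (single w0 a) (w0 + l - i) =
      mat_coeff z' i (w0 + l - i) * (step z' ^^ k') (single w0 a) (w0 + l - i)" if "i \<in> {1..w0 + l}" for i
    proof (cases "i < l")
      case True
      have "(step z ^^ k') (single w0 a) (w0 + l - i) = (step z' ^^ k') (single w0 a) (w0 + l - i)"
        using assms that True by (intro funpow_step_single_cong[of "l - 1"]) auto
      moreover have "mat_coeff z i j = mat_coeff z' i j" for j using assms that True by (intro mat_coeff_cong) auto
      ultimately show ?thesis by simp
    next
      case False
      \<comment> \<open>A last jump of length at least \<open>l\<close> leaves no room for the
        \<open>k' \<ge> 1\<close> jumps before it.\<close>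
      then have "w0 + l - i < w0 + k'" using that k' by auto
      then show ?thesis by (simp add: funpow_step_single_lt)
    qed
    then show ?thesis
      unfolding k' funpow.simps comp_def step_def[of z "(step z ^^ k') (single w0 a)"]
        step_def[of z' "(step z' ^^ k') (single w0 a)"] by (rule sum.cong[OF refl])
  qed
  then show ?thesis unfolding higher_terms_def by (intro sum.cong) auto
qed

lemma exp_step_single_lt: "w < w0 \<Longrightarrow> exp_step z (single w0 a) w = 0"
  unfolding exp_step_def by (intro sum.neutral) (simp add: funpow_step_single_lt)

lemma exp_step_single_eq: "exp_step z (single w0 a) w0 = a"
proof -
  have "exp_step z (single w0 a) w0 = (\<Sum>k\<in>{0}. gconst (1 / fact k) * (step z ^^ k) (single w0 a) w0)"
    unfolding exp_step_def by (rule sum.mono_neutral_right) (auto simp: funpow_step_single_lt)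
  then show ?thesis by (simp add: single_def)
qed

text \<open>A single jump over distance \<open>l\<close> uses the entry of level \<open>l\<close>,
  so that level enters linearly and with the leading coefficient as factor.\<close>

lemma exp_step_single_add:
  assumes "l \<ge> 1" "w0 \<ge> 1"
  shows "exp_step z (single w0 a) (w0 + l) = mat_coeff z l w0 * a + higher_terms w0 a l z"
proof -
  have "{..w0 + l} = {0, 1} \<union> {2..w0 + l}" using assms by auto
  then have "exp_step z (single w0 a) (w0 + l) =
      (\<Sum>k\<in>{0, 1}. gconst (1 / fact k) * (step z ^^ k) (single w0 a) (w0 + l)) + higher_terms w0 a l z"
    unfolding exp_step_def higher_terms_def by (simp only:) (rule sum.union_disjoint; auto)
  moreover have "step z (single w0 a) (w0 + l) = mat_coeff z l w0 * a"
  proof -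
    have "step z (single w0 a) (w0 + l) = (\<Sum>k\<in>{l}. mat_coeff z k (w0 + l - k) * single w0 a (w0 + l - k))"
      unfolding step_def using assms by (intro sum.mono_neutral_right) (auto simp: single_def)
    then show ?thesis by (simp add: single_def)
  qed
  ultimately show ?thesis using assms by (simp add: single_def)
qed

lemma exp_step_single_parity:
  assumes "\<And>k. k \<ge> 1 \<Longrightarrow> z k \<in> Grass_part L k \<times> Grass_part L k" "a \<in> \<Lambda>\<^sup>0 L"
  shows "exp_step z (single w0 a) w \<in> Grass_part L (w + w0)"
  unfolding exp_step_def by (intro Grass_part_sum Grass_part_gconst_mult funpow_step_single_parity assms)

lemma higher_terms_parity:
  assumes "\<And>k. 1 \<le> k \<Longrightarrow> k < l \<Longrightarrow> z k \<in> Grass_part L k \<times> Grass_part L k" "a \<in> \<Lambda>\<^sup>0 L"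
  shows "higher_terms w0 a l z \<in> Grass_part L l"
proof -
  \<comment> \<open>Parities are known below \<open>l\<close> only. Zero entries from
    \<open>l\<close> on satisfy the parity condition too and leave the value unchanged.\<close>
  define z' where "z' = (\<lambda>k. if k < l then z k else (0, 0))"
  have "higher_terms w0 a l z = higher_terms w0 a l z'" by (rule higher_terms_cong) (simp add: z'_def)
  also have "\<dots> \<in> Grass_part L (w0 + l + w0)"
    unfolding higher_terms_def
    by (intro Grass_part_sum Grass_part_gconst_mult funpow_step_single_parity assms(2))
      (use assms(1) in \<open>auto simp: z'_def\<close>)
  also have "\<dots> = Grass_part L l" by (rule Grass_part_cong) presburger
  finally show ?thesis .
qed

section \<open>The bijection at zero\<close>

lemma comm_group_even_units: "comm_group (even_units L)"
proof -
  have "comm_monoid (even_monoid L)"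
    by (rule comm_monoidI)
      (auto simp: even_monoid_def Grass_even_mult mult.assoc intro: Grass_part_commute[of 0])
  then show ?thesis unfolding even_units_def by (rule comm_monoid.units_comm_group)
qed

lemma group_even_units: "group (even_units L)"
  using comm_group_even_units by (rule comm_group.axioms)

lemma even_units_simps [simp]:
  "carrier (even_units L) = Units (even_monoid L)"
  "monoid.mult (even_units L) = (*)" "monoid.one (even_units L) = 1"
  by (simp_all add: even_units_def units_of_def even_monoid_def)

lemma Units_even_monoid_closed:
  assumes "a \<in> Units (even_monoid L)"
  shows "a \<in> \<Lambda>\<^sup>0 L" "- a \<in> Units (even_monoid L)"
    "b \<in> Units (even_monoid L) \<Longrightarrow> a * b \<in> Units (even_monoid L)"
    "inv\<^bsub>even_units L\<^esub> a \<in> Units (even_monoid L)"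
  using assms group.inv_closed[OF group_even_units, of a L]
  by (auto simp: Units_even_monoid Grass_even_mult gcoeff_mult_empty)

lemma inv_even_units:
  assumes "a \<in> Units (even_monoid L)"
  shows "a * inv\<^bsub>even_units L\<^esub> a = 1" "inv\<^bsub>even_units L\<^esub> a * a = 1"
  using group.r_inv[OF group_even_units, of a L] group.l_inv[OF group_even_units, of a L] assms by simp_all

lemma one_Units: "1 \<in> Units (even_monoid L)"
  by (simp add: Units_even_monoid gcoeff_one)

lemma base_zero_eq:
  assumes "a1 \<in> Units (even_monoid L)" "a2 \<in> Units (even_monoid L)"
  shows "base_zero L (a1, a2) = (weight_series (single 2 (a1 * a1)), weight_series (single 1 (a1 * inv\<^bsub>even_units L\<^esub> a2)))"
proof -
  interpret group "even_units L" by (rule group_even_units)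
  have "a1 * a1 \<in> carrier (even_units L)" using assms Units_even_monoid_closed(3) by simp
  then have p: "(a1 * a1) [^]\<^bsub>even_units L\<^esub> (1 :: int) = a1 * a1"
    "(a1 * a1) [^]\<^bsub>even_units L\<^esub> (0 :: int) = 1" 
    by simp_all
  have q: "1 [^]\<^bsub>even_units L\<^esub> (n :: int) = 1" for n
    using int_pow_one[of n] by simp
  show ?thesis
    unfolding base_zero_def Let_def
    by (auto simp: pow_minus_2L0_def pow_minus_J0_def rescale_def var_x_def var_phi_def single_def p q
        nat_eq_iff intro!: superseries_eqI)
qed

text \<open>In terms of weights the exponent ranges say that the first component starts at weight 2
  and the second at weight 1. Coefficient parity is the parity of the weight, shifted by that of the
  component, and invertibility concerns the two leading coefficients.\<close>

lemma functions_zero_iff: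
  "f \<in> functions_zero L \<longleftrightarrow> (\<exists>u v. f = (weight_series u, weight_series v) \<and>
     (\<forall>w. u w \<in> Grass_part L w) \<and> (\<forall>w. v w \<in> Grass_part L (w + 1)) \<and>
     u 0 = 0 \<and> u 1 = 0 \<and> v 0 = 0 \<and>
     u 2 \<in> Units (even_monoid L) \<and> v 1 \<in> Units (even_monoid L))" (is "_ \<longleftrightarrow> ?R f")
proof
  have par: "Grass_part L (2 * n) = \<Lambda>\<^sup>0 L" "Grass_part L (Suc (2 * n)) = \<Lambda>\<^sup>1 L"
    "Grass_part L (Suc (Suc (2 * n))) = \<Lambda>\<^sup>0 L" for n
    by (rule Grass_part_cong; simp)+
  {
    assume f: "f \<in> functions_zero L"
    let ?c = "\<lambda>u w. if even w then cf0 u (int (w div 2)) else cf1 u (int (w div 2))"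
    have "fst f = weight_series (?c (fst f))" "snd f = weight_series (?c (snd f))"
      by (rule eq_weight_series; use f in \<open>auto simp: functions_zero_def series_in_def mem_Times_iff\<close>)+
    then have "f = (weight_series (?c (fst f)), weight_series (?c (snd f)))" by (simp add: prod_eq_iff)
    moreover have "?c (fst f) w \<in> Grass_part L w" "?c (snd f) w \<in> Grass_part L (w + 1)" for w
    proof -
      have "cf0 (fst f) n \<in> \<Lambda>\<^sup>0 L" "cf1 (fst f) n \<in> \<Lambda>\<^sup>1 L" "cf0 (snd f) n \<in> \<Lambda>\<^sup>1 L" "cf1 (snd f) n \<in> \<Lambda>\<^sup>0 L" for n
        using f by (auto simp: functions_zero_def series_in_def mem_Times_iff)
      then show "?c (fst f) w \<in> Grass_part L w" "?c (snd f) w \<in> Grass_part L (w + 1)"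
        by (cases "even w"; auto elim!: evenE oddE simp: par)+
    qed
    moreover have "?c (fst f) 0 = 0" "?c (fst f) 1 = 0" "?c (snd f) 0 = 0"
      "?c (fst f) 2 \<in> Units (even_monoid L)" "?c (snd f) 1 \<in> Units (even_monoid L)"
      using f by (auto simp: functions_zero_def series_in_def mem_Times_iff invertible_zero_def)
    ultimately show "?R f" by blast
  }
  assume "?R f"
  then obtain u v where f: "f = (weight_series u, weight_series v)" and
    *: "u w \<in> Grass_part L w" "v w \<in> Grass_part L (w + 1)" and
    **: "u 0 = 0" "u 1 = 0" "v 0 = 0" "u 2 \<in> Units (even_monoid L)" "v 1 \<in> Units (even_monoid L)" for w
    by blast
  have p: "u (2 * n) \<in> \<Lambda>\<^sup>0 L" "u (Suc (2 * n)) \<in> \<Lambda>\<^sup>1 L" "v (2 * n) \<in> \<Lambda>\<^sup>1 L" "v (Suc (2 * n)) \<in> \<Lambda>\<^sup>0 L" for n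
    using *(1)[of "2 * n"] *(1)[of "Suc (2 * n)"] *(2)[of "2 * n"] *(2)[of "Suc (2 * n)"]
    by (simp_all add: par)
  have l: "n < 1 \<Longrightarrow> n < 0 \<or> n = 0" for n :: int by linarith
  show "f \<in> functions_zero L"
    unfolding functions_zero_def superanalytic_def f
    using p ** by (auto simp: SSeries_part_iff series_in_def invertible_zero_def not_le dest!: l)
qed

text \<open>The inverse \<open>?g\<close> solves the 2 by 2 systems. At even levels A1 is the second
  entry and A2 follows from the first; at odd levels half the sum is M1, and the difference -2i M2
  explains the factor i/2.\<close>

lemma bij_betw_field_coeffs:
  "bij_betw field_coeffs (param_seqs L) (\<Pi>\<^sub>E k\<in>{1..}. Grass_part L k \<times> Grass_part L k)"
proof (rule bij_betwI)
  let ?Z = "\<Pi>\<^sub>E k\<in>{1..}. Grass_part L k \<times> Grass_part L k"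
  let ?g = "\<lambda>z. (\<lambda>n\<in>{1::nat..}. snd (z (2 * n)),
    \<lambda>n\<in>{1::nat..}. gconst (of_nat (n + 1) / 2) * snd (z (2 * n)) - fst (z (2 * n)),
    \<lambda>n\<in>{1::nat..}. gconst (1 / 2) * (fst (z (2 * n - 1)) + snd (z (2 * n - 1))),
    \<lambda>n\<in>{1::nat..}. gconst (\<i> / 2) * (fst (z (2 * n - 1)) - snd (z (2 * n - 1))))"
  have par: "even k \<Longrightarrow> Grass_part L k = \<Lambda>\<^sup>0 L" "odd k \<Longrightarrow> Grass_part L k = \<Lambda>\<^sup>1 L" for k
    by (rule Grass_part_cong; simp)+
  show "field_coeffs \<in> param_seqs L \<rightarrow> ?Z"
  proof
    fix s assume "s \<in> param_seqs L"
    moreover obtain A1 A2 M1 M2 where s: "s = (A1, A2, M1, M2)" by (cases s)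
    ultimately have m: "A1 n \<in> \<Lambda>\<^sup>0 L" "A2 n \<in> \<Lambda>\<^sup>0 L" "M1 n \<in> \<Lambda>\<^sup>1 L" "M2 n \<in> \<Lambda>\<^sup>1 L" if "n \<ge> 1" for n
      using that unfolding param_seqs_def even_seqs_def odd_seqs_def by (auto simp: PiE_iff)
    show "field_coeffs s \<in> ?Z"
    proof (rule PiE_I)
      fix k :: nat assume "k \<in> {1..}"
      then have "Suc k div 2 \<ge> 1" by simp
      from m[OF this] \<open>k \<in> {1..}\<close> show "field_coeffs s k \<in> Grass_part L k \<times> Grass_part L k"
        using par[of k] unfolding s field_coeffs_def by (cases "even k") (simp_all add: Let_def)
    qed (simp add: field_coeffs_def s)
  qed
  show "?g \<in> ?Z \<rightarrow> param_seqs L"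
  proof
    fix z assume z: "z \<in> ?Z"
    have "z (2 * n) \<in> \<Lambda>\<^sup>0 L \<times> \<Lambda>\<^sup>0 L" "z (2 * n - 1) \<in> \<Lambda>\<^sup>1 L \<times> \<Lambda>\<^sup>1 L" if "n \<ge> 1" for n
      using that PiE_mem[OF z, of "2 * n"] PiE_mem[OF z, of "2 * n - 1"] par[of "2 * n"] par[of "2 * n - 1"] by auto
    then show "?g z \<in> param_seqs L"
      unfolding param_seqs_def even_seqs_def odd_seqs_def by (auto simp: mem_Times_iff)
  qed
  show "?g (field_coeffs s) = s" if "s \<in> param_seqs L" for s
  proof -
    obtain A1 A2 M1 M2 where s: "s = (A1, A2, M1, M2)" by (cases s)
    have o: "odd (2 * n - 1)" "2 * n - 1 \<ge> 1" "Suc (2 * n - 1) div 2 = n" if "n \<ge> 1" for n :: nat using that by auto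
    have f: "field_coeffs s (2 * n) = (gconst (of_nat (n + 1) / 2) * A1 n - A2 n, A1 n)"
      "field_coeffs s (2 * n - 1) = (M1 n - gconst \<i> * M2 n, M1 n + gconst \<i> * M2 n)" if "n \<ge> 1" for n
      using that o[of n] unfolding field_coeffs_def s by (simp_all add: Let_def)
    have "A1 \<in> extensional {1..}" "A2 \<in> extensional {1..}" "M1 \<in> extensional {1..}" "M2 \<in> extensional {1..}"
      using that unfolding s param_seqs_def even_seqs_def odd_seqs_def by (auto simp: PiE_iff)
    moreover have "gconst (1 / 2) * (M1 n - gconst \<i> * M2 n + (M1 n + gconst \<i> * M2 n)) = M1 n"
      "gconst (\<i> / 2) * (M1 n - gconst \<i> * M2 n - (M1 n + gconst \<i> * M2 n)) = M2 n" for n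
      by (rule grassmann_eqI, simp add: algebra_simps)+
    ultimately show ?thesis
      unfolding s by (auto simp: f[unfolded s] fun_eq_iff restrict_def extensional_def simp del: One_nat_def)
  qed
  show "field_coeffs (?g z) = z" if z: "z \<in> ?Z" for z
  proof
    fix k
    have r: "gconst (1 / 2) * (a + b) - gconst \<i> * (gconst (\<i> / 2) * (a - b)) = a"
      "gconst (1 / 2) * (a + b) + gconst \<i> * (gconst (\<i> / 2) * (a - b)) = b" for a b
      by (rule grassmann_eqI, simp add: right_diff_distrib distrib_left; simp add: field_simps)+
    consider "k = 0" | n where "k = 2 * n" "n \<ge> 1" | n where "k = 2 * n - 1" "n \<ge> 1" "odd k" "Suc k div 2 = n"
    proof (cases "even k")
      case True
      then obtain n where "k = 2 * n" by blast
      with that(1,2) show ?thesis by (cases "n \<ge> 1") auto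
    next
      case False
      then obtain n where "k = 2 * n + 1" by (rule oddE)
      with that(3)[of "n + 1"] show ?thesis by simp
    qed
    then show "field_coeffs (?g z) k = z k"
    proof cases
      case 1
      then show ?thesis using z by (simp add: field_coeffs_def PiE_iff extensional_def)
    next
      case 2
      then show ?thesis by (simp add: field_coeffs_def Let_def)
    next
      case 3
      then have "1 \<le> k" by simp
      with 3(2-4) show ?thesis by (simp add: field_coeffs_def Let_def r flip: 3(1) del: One_nat_def)
    qed
  qed
qed

definition exp_pair :: "(grassmann \<times> grassmann) \<times> (nat \<Rightarrow> grassmann \<times> grassmann) \<Rightarrow> superseries \<times> superseries" where
  "exp_pair = (\<lambda>((c, d), z). (weight_series (exp_step z (single 2 c)), weight_series (exp_step z (single 1 d))))"

text \<open>At distance \<open>l\<close> each coefficient is a new entry times a unit plus terms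
  from lower levels. Equality of entries thus propagates by induction on \<open>l\<close>, and
  prescribed coefficients determine the entries level by level.\<close>

lemma bij_betw_exp_pair:
  "bij_betw exp_pair ((Units (even_monoid L) \<times> Units (even_monoid L)) \<times>
     (\<Pi>\<^sub>E k\<in>{1..}. Grass_part L k \<times> Grass_part L k)) (functions_zero L)"
  (is "bij_betw _ (?U \<times> ?Z) _")
  unfolding bij_betw_def
proof
  have coef: "exp_step z (single 2 c) (2 + l) = snd (z l) * c + higher_terms 2 c l z"
    "exp_step z (single 1 d) (1 + l) = fst (z l) * d + higher_terms 1 d l z" if "l \<ge> 1" for z c d l
    using exp_step_single_add[OF that, of 2 z c] exp_step_single_add[OF that, of 1 z d] by simp_all
  show "inj_on exp_pair (?U \<times> ?Z)"
  proof (rule inj_onI)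
    fix p p'
    assume p: "p \<in> ?U \<times> ?Z" "p' \<in> ?U \<times> ?Z" and ep: "exp_pair p = exp_pair p'"
    obtain c d z c' d' z' where pp: "p = ((c, d), z)" "p' = ((c', d'), z')" by (metis surj_pair)
    have U: "c \<in> Units (even_monoid L)" "d \<in> Units (even_monoid L)"
      and Z: "z \<in> ?Z" "z' \<in> ?Z" and eq: "exp_pair ((c, d), z) = exp_pair ((c', d'), z')"
      using p ep unfolding pp by blast+
    have E: "exp_step z (single 2 c) w = exp_step z' (single 2 c') w"
      "exp_step z (single 1 d) w = exp_step z' (single 1 d') w" for w
      using eq by (simp_all add: exp_pair_def weight_series_eq_iff)
    have cd: "c = c'" "d = d'" using E(1)[of 2] E(2)[of 1] by (simp_all only: exp_step_single_eq)
    have cancel: "x = y" if "x * u = y * u" "u \<in> Units (even_monoid L)" for x y u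
      using that inv_even_units(1)[of u L] by (metis mult.assoc mult_1_right)
    have "z l = z' l" if "l \<ge> 1" for l
      using that
    proof (induction l rule: less_induct)
      case (less l)
      then have "higher_terms w0 a l z = higher_terms w0 a l z'" for w0 a by (intro higher_terms_cong) auto
      then have "snd (z l) * c = snd (z' l) * c" "fst (z l) * d = fst (z' l) * d"
        using E(1)[of "2 + l"] E(2)[of "1 + l"] coef[OF less.prems] cd by auto
      then show ?case using cancel U by (simp add: prod_eq_iff)
    qed
    with Z have "z = z'" by (intro PiE_ext[of z "{1..}" _ z']) auto
    with cd show "p = p'" unfolding pp by simp
  qed
  show "exp_pair ` (?U \<times> ?Z) = functions_zero L"
  proof (intro equalityI subsetI)
    fix f assume "f \<in> exp_pair ` (?U \<times> ?Z)"
    then obtain c d z where U: "c \<in> Units (even_monoid L)" "d \<in> Units (even_monoid L)"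
      and Z: "z \<in> ?Z" and f: "f = (weight_series (exp_step z (single 2 c)), weight_series (exp_step z (single 1 d)))"
      by (auto simp: exp_pair_def)
    have "exp_step z (single 2 c) w \<in> Grass_part L (w + 2)" "exp_step z (single 1 d) w \<in> Grass_part L (w + 1)" for w
      using U(1,2)[THEN Units_even_monoid_closed(1)] PiE_mem[OF Z] by (intro exp_step_single_parity; simp)+
    moreover have "Grass_part L (w + 2) = Grass_part L w" for w by simp
    ultimately show "f \<in> functions_zero L"
      unfolding functions_zero_iff using f U
      by (intro exI[of _ "exp_step z (single 2 c)"] exI[of _ "exp_step z (single 1 d)"])
        (auto simp: exp_step_single_lt exp_step_single_eq[of z 2] exp_step_single_eq[of z 1, simplified])
  next
    fix f assume "f \<in> functions_zero L"
    then obtain u v where f: "f = (weight_series u, weight_series v)"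
      and par: "u w \<in> Grass_part L w" "v w \<in> Grass_part L (w + 1)"
      and 0: "u 0 = 0" "u 1 = 0" "v 0 = 0"
      and U: "u 2 \<in> Units (even_monoid L)" "v 1 \<in> Units (even_monoid L)" for w
      unfolding functions_zero_iff by blast
    define c c' d d' where "c = u 2" and "c' = inv\<^bsub>even_units L\<^esub> c" and "d = v 1" and "d' = inv\<^bsub>even_units L\<^esub> d"
    have c: "c \<in> \<Lambda>\<^sup>0 L" "c' \<in> \<Lambda>\<^sup>0 L" "c' * c = 1" and d: "d \<in> \<Lambda>\<^sup>0 L" "d' \<in> \<Lambda>\<^sup>0 L" "d' * d = 1"
      using U Units_even_monoid_closed(1,4) inv_even_units(2) unfolding c_def c'_def d_def d'_def by blast+
    \<comment> \<open>The solution of \<open>coef\<close> for level \<open>l\<close>; it refers to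
      \<open>z\<close> below \<open>l\<close> only, as well-founded choice requires. The value
      \<open>undefined\<close> at 0 puts \<open>z\<close> into the extensional product.\<close>
    define P where "P z l r \<longleftrightarrow> r = (if l \<ge> 1 then ((v (1 + l) - higher_terms 1 d l z) * d', (u (2 + l) - higher_terms 2 c l z) * c') else undefined)" for z and l :: nat and r
    have "\<exists>z. \<forall>l. P z l (z l)"
    proof (rule dependent_wf_choice[OF wf_less])
      fix z z' :: "nat \<Rightarrow> grassmann \<times> grassmann" and l r
      assume "\<And>y. (y, l) \<in> {(x, y). x < y} \<Longrightarrow> z y = z' y"
      then have "higher_terms w0 a l z = higher_terms w0 a l z'" for w0 a by (intro higher_terms_cong) auto
      then show "P z l r = P z' l r" unfolding P_def by simp
    qed (simp add: P_def)
    then obtain z where z: "P z l (z l)" for l by blast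
    have fst_z: "fst (z l) = (v (1 + l) - higher_terms 1 d l z) * d'" and snd_z: "snd (z l) = (u (2 + l) - higher_terms 2 c l z) * c'"
      if "l \<ge> 1" for l
      using z[of l] that by (simp_all add: P_def)
    \<comment> \<open>Parities come after the construction, since those of
      \<open>higher_terms\<close> rest on the entries at lower levels.\<close>
    have z_par: "z l \<in> Grass_part L l \<times> Grass_part L l" if "l \<ge> 1" for l
      using that
    proof (induction l rule: less_induct)
      case (less l)
      then have "higher_terms w0 a l z \<in> Grass_part L l" if "a \<in> \<Lambda>\<^sup>0 L" for w0 a
        using that by (intro higher_terms_parity) auto
      moreover have "v (1 + l) \<in> Grass_part L l" "u (2 + l) \<in> Grass_part L l"
        using par(1)[of "2 + l"] par(2)[of "1 + l"] by simp_all
      ultimately have "v (1 + l) - higher_terms 1 d l z \<in> Grass_part L l" "u (2 + l) - higher_terms 2 c l z \<in> Grass_part L l"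
        using c d by (intro Grass_part_diff; blast)+
      from this[THEN Grass_part_mult] c d have "fst (z l) \<in> Grass_part L (l + 0)" "snd (z l) \<in> Grass_part L (l + 0)"
        unfolding fst_z[OF less.prems] snd_z[OF less.prems] by blast+
      then show ?case by (simp add: mem_Times_iff)
    qed
    have "z 0 = undefined" using z[of 0] by (simp add: P_def)
    with z_par have "z \<in> ?Z" by (auto simp: PiE_iff extensional_def not_le)
    moreover have "exp_step z (single 2 c) w = u w" for w
    proof -
      consider "w = 0" | "w = 1" | "w = 2" | l where "w = 2 + l" "l \<ge> 1"
        by (metis One_nat_def Suc_1 Suc_leI add_2_eq_Suc gr0I less_2_cases less_imp_Suc_add not_less_eq add_Suc_right add.right_neutral)
      then show ?thesis
        by cases (use 0 c in \<open>simp_all add: exp_step_single_lt exp_step_single_eq c_def[symmetric] coef snd_z mult.assoc del: add_2_eq_Suc\<close>)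
    qed
    moreover have "exp_step z (single 1 d) w = v w" for w
    proof -
      consider "w = 0" | "w = 1" | l where "w = 1 + l" "l \<ge> 1"
        by (cases w; cases "w - 1") auto
      then show ?thesis
        by cases (use 0 d exp_step_single_eq[of z 1] in \<open>simp_all add: exp_step_single_lt d_def[symmetric] coef fst_z mult.assoc del: One_nat_def\<close>)
    qed
    ultimately show "f \<in> exp_pair ` (?U \<times> ?Z)"
      using U unfolding f c_def[symmetric] d_def[symmetric]
      by (intro image_eqI[of _ _ "((c, d), z)"]) (auto simp: exp_pair_def weight_series_eq_iff fun_eq_iff)
  qed
qed

section \<open>Leading coefficients and the quotient by the common sign\<close>

lemma unit_pairs_simps [simp]:
  "carrier (unit_pairs L) = Units (even_monoid L) \<times> Units (even_monoid L)"
  "x \<otimes>\<^bsub>unit_pairs L\<^esub> y = (fst x * fst y, snd x * snd y)"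
  "\<one>\<^bsub>unit_pairs L\<^esub> = (1, 1)"
  by (simp_all add: unit_pairs_def DirProd_def case_prod_unfold)

lemma group_unit_pairs: "group (unit_pairs L)"
  unfolding unit_pairs_def by (intro DirProd_group group_even_units)

lemma inv_even_units_uminus:
  assumes "a \<in> Units (even_monoid L)"
  shows "inv\<^bsub>even_units L\<^esub> (- a) = - (inv\<^bsub>even_units L\<^esub> a)"
  by (rule group.inv_equality[OF group_even_units])
    (use assms in \<open>simp_all add: Units_even_monoid_closed inv_even_units\<close>)

lemma sign_subgroup_eq: "sign_subgroup L = {(1, 1), (-1, -1)}"
proof -
  have m1: "-1 \<in> Units (even_monoid L)" using one_Units Units_even_monoid_closed(2) by blast
  have "inv\<^bsub>unit_pairs L\<^esub> (-1, -1) = (-1, -1)"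
    by (rule group.inv_equality[OF group_unit_pairs]) (use m1 in simp_all)
  then have "x \<in> {(1, 1), (-1, -1)}" if "x \<in> generate (unit_pairs L) {(-1, -1)}" for x
    using that(1) by (induction rule: generate.induct[OF that(1)]) auto
  moreover have "(1, 1) \<in> generate (unit_pairs L) {(-1, -1)}"
    using generate.one[of "unit_pairs L"] by simp
  moreover have "(-1, -1) \<in> generate (unit_pairs L) {(-1, -1)}" by (rule generate.incl) simp
  ultimately show ?thesis unfolding sign_subgroup_def by blast
qed

lemma sign_subgroup_rcoset:
  "sign_subgroup L #>\<^bsub>unit_pairs L\<^esub> a = {a, (- fst a, - snd a)}"
  by (auto simp: r_coset_def sign_subgroup_eq)

text \<open>A homomorphism of unit groups with kernel {(1, 1), (-1, -1)}: if the square of a1 is 1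
  and a1 = a2, both are the same sign.\<close>

definition leading_coeffs :: "enat \<Rightarrow> grassmann \<times> grassmann \<Rightarrow> grassmann \<times> grassmann" where
  "leading_coeffs L a = (fst a * fst a, fst a * inv\<^bsub>even_units L\<^esub> (snd a))"

definition coset_leading_coeffs :: "enat \<Rightarrow> (grassmann \<times> grassmann) set \<Rightarrow> grassmann \<times> grassmann" where
  "coset_leading_coeffs L K = the_elem (leading_coeffs L ` K)"

text \<open>The two representatives of a coset differ by a common sign, which cancels in the square
  and in the quotient, so \<open>the_elem\<close> is applied to a singleton.\<close>

lemma coset_leading_coeffs_rcoset:
  assumes "a \<in> carrier (unit_pairs L)"
  shows "coset_leading_coeffs L (sign_subgroup L #>\<^bsub>unit_pairs L\<^esub> a) = leading_coeffs L a"
proof -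
  have "leading_coeffs L ` (sign_subgroup L #>\<^bsub>unit_pairs L\<^esub> a) = {leading_coeffs L a}"
    using assms unfolding sign_subgroup_rcoset
    by (auto simp: leading_coeffs_def inv_even_units_uminus)
  then show ?thesis by (simp add: coset_leading_coeffs_def)
qed

text \<open>Injectivity is uniqueness of square roots up to sign, the quotient of the two units
  passing the sign on to the second one. Surjectivity is existence of square roots.\<close>

lemma bij_betw_coset_leading_coeffs:
  "bij_betw (coset_leading_coeffs L) (carrier (unit_pairs L Mod sign_subgroup L))
     (Units (even_monoid L) \<times> Units (even_monoid L))" (is "bij_betw _ ?Q ?U")
proof -
  have Q: "K \<in> ?Q \<longleftrightarrow> (\<exists>a\<in>carrier (unit_pairs L). K = sign_subgroup L #>\<^bsub>unit_pairs L\<^esub> a)" for K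
    by (auto simp: FactGroup_def RCOSETS_def)
  show ?thesis
    unfolding bij_betw_def
  proof (rule conjI[OF inj_onI equalityI[OF subsetI subsetI]])
    fix K K' assume "K \<in> ?Q" "K' \<in> ?Q" "coset_leading_coeffs L K = coset_leading_coeffs L K'"
    then obtain a b where ab: "a \<in> carrier (unit_pairs L)" "b \<in> carrier (unit_pairs L)"
      and K: "K = sign_subgroup L #>\<^bsub>unit_pairs L\<^esub> a" "K' = sign_subgroup L #>\<^bsub>unit_pairs L\<^esub> b"
      and eq: "leading_coeffs L a = leading_coeffs L b"
      unfolding Q by (auto simp: coset_leading_coeffs_rcoset)
    obtain a1 a2 b1 b2 where p: "a = (a1, a2)" "b = (b1, b2)" by (metis surj_pair)
    with ab have U: "a1 \<in> Units (even_monoid L)" "a2 \<in> Units (even_monoid L)"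
      "b1 \<in> Units (even_monoid L)" "b2 \<in> Units (even_monoid L)" by auto
    let ?i = "\<lambda>x. inv\<^bsub>even_units L\<^esub> x"
    have snd_eq: "y = y'" if "x * ?i y = x * ?i y'" "x \<in> Units (even_monoid L)"
      "y \<in> Units (even_monoid L)" "y' \<in> Units (even_monoid L)" for x y y'
    proof -
      have "?i x * (x * w) = w" for w using that by (simp add: inv_even_units flip: mult.assoc)
      then have "?i y = ?i y'" using that by metis
      then have "y * ?i y' = 1" using that inv_even_units(1)[of y L] by simp
      then have "y * ?i y' * y' = y'" by simp
      then show ?thesis using that by (simp add: inv_even_units mult.assoc)
    qed
    have sq: "a1 * a1 = b1 * b1" and q: "a1 * ?i a2 = b1 * ?i b2"
      using eq unfolding leading_coeffs_def p by simp_all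
    from square_eq_Units[OF U(1,3) sq] have "a = b \<or> a = (- b1, - b2)"
    proof
      assume "a1 = b1"
      with q snd_eq[of b1 a2 b2] U show ?thesis by (simp add: p)
    next
      assume "a1 = - b1"
      with q have "b1 * ?i (- a2) = b1 * ?i b2" using U by (simp add: inv_even_units_uminus)
      with snd_eq[of b1 "- a2" b2] U have "- a2 = b2" by (simp add: Units_even_monoid_closed)
      with \<open>a1 = - b1\<close> show ?thesis by (auto simp: p)
    qed
    then show "K = K'" unfolding K sign_subgroup_rcoset p by auto
  next
    fix y assume "y \<in> coset_leading_coeffs L ` ?Q"
    then obtain K where "K \<in> ?Q" "y = coset_leading_coeffs L K" by blast
    then obtain a where "a \<in> carrier (unit_pairs L)" "y = leading_coeffs L a"
      unfolding Q using coset_leading_coeffs_rcoset by blast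
    then show "y \<in> ?U" by (auto simp: leading_coeffs_def Units_even_monoid_closed)
  next
    fix y assume y: "y \<in> ?U"
    obtain c d where cd: "y = (c, d)" "c \<in> Units (even_monoid L)" "d \<in> Units (even_monoid L)"
      using y by auto
    obtain b where b: "b \<in> \<Lambda>\<^sup>0 L" "b * b = c"
      using Grass_even_sqrt[of c L] cd unfolding Units_even_monoid by blast
    with cd have bU: "b \<in> Units (even_monoid L)"
      using gcoeff_mult_empty[of b b] by (auto simp: Units_even_monoid)
    let ?i = "\<lambda>x. inv\<^bsub>even_units L\<^esub> x"
    \<comment> \<open>The preimage of (c, d) is (b, b / d) with b a root of c; here the second entry
      is inverted.\<close>
    have i: "?i (?i d * b) = ?i b * d"
    proof (rule group.inv_equality[OF group_even_units])
      have "?i b * d * (?i d * b) = ?i b * (d * ?i d) * b" by (simp add: mult.assoc)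
      then show "?i b * d \<otimes>\<^bsub>even_units L\<^esub> (?i d * b) = \<one>\<^bsub>even_units L\<^esub>"
        using cd bU by (simp add: inv_even_units)
    qed (use cd bU in \<open>simp_all add: Units_even_monoid_closed\<close>)
    have "leading_coeffs L (b, ?i d * b) = y"
      using cd b bU unfolding leading_coeffs_def
      by (simp add: i inv_even_units flip: mult.assoc)
    moreover have "(b, ?i d * b) \<in> carrier (unit_pairs L)"
      using cd bU by (simp add: Units_even_monoid_closed)
    ultimately have "y = coset_leading_coeffs L (sign_subgroup L #>\<^bsub>unit_pairs L\<^esub> (b, ?i d * b))"
      and "sign_subgroup L #>\<^bsub>unit_pairs L\<^esub> (b, ?i d * b) \<in> ?Q"
      unfolding Q by (simp only: coset_leading_coeffs_rcoset, blast)
    then show "y \<in> coset_leading_coeffs L ` ?Q" by (rule image_eqI)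
  qed
qed

lemma expression_zero_eq:
  assumes "a \<in> carrier (unit_pairs L)" "(A1, A2, M1, M2) \<in> param_seqs L"
  shows "expression_zero_exists L a A1 A2 M1 M2"
    and "expression_zero L a A1 A2 M1 M2 = exp_pair (leading_coeffs L a, field_coeffs (A1, A2, M1, M2))"
proof -
  obtain a1 a2 where a: "a = (a1, a2)" by (cases a)
  with assms(1) base_zero_eq[of a1 L a2]
  have b: "base_zero L a = (weight_series (single 2 (a1 * a1)), weight_series (single 1 (a1 * inv\<^bsub>even_units L\<^esub> a2)))"
    by simp
  show "expression_zero_exists L a A1 A2 M1 M2"
    unfolding expression_zero_exists_def b by (simp add: exp_sum_exists_terms_zero[OF assms(2)])
  show "expression_zero L a A1 A2 M1 M2 = exp_pair (leading_coeffs L a, field_coeffs (A1, A2, M1, M2))"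
    unfolding expression_zero_def b Let_def exp_pair_def
    by (simp add: exp_sum_terms_zero[OF assms(2)] leading_coeffs_def a)
qed

definition expansion_zero ::
  "enat \<Rightarrow> (grassmann \<times> grassmann) set \<times> gseq \<times> gseq \<times> gseq \<times> gseq \<Rightarrow> superseries \<times> superseries" where
  "expansion_zero L = exp_pair \<circ> map_prod (coset_leading_coeffs L) field_coeffs"

lemma bij_betw_expansion_zero: "bij_betw (expansion_zero L) (parameters L) (functions_zero L)"
proof -
  have "parameters L = carrier (unit_pairs L Mod sign_subgroup L) \<times> param_seqs L"
    by (simp add: parameters_def param_seqs_def)
  then show ?thesis unfolding expansion_zero_def
    using bij_betw_trans[OF bij_betw_map_prod[OF bij_betw_coset_leading_coeffs bij_betw_field_coeffs] bij_betw_exp_pair]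
    by metis
qed

lemma expansion_zero_eq:
  assumes "a \<in> carrier (unit_pairs L)" "(A1, A2, M1, M2) \<in> param_seqs L"
  shows "expansion_zero L (sign_subgroup L #>\<^bsub>unit_pairs L\<^esub> a, A1, A2, M1, M2) = expression_zero L a A1 A2 M1 M2"
  using assms by (simp add: expansion_zero_def expression_zero_eq(2) coset_leading_coeffs_rcoset)

section \<open>The bijection at infinity\<close>

text \<open>The substitution is not an involution: its square fixes x and sends \<phi> to -\<phi>.
  Hence the factor i instead of -i.\<close>

definition subst_inversion_inv :: "superseries \<Rightarrow> superseries" where
  "subst_inversion_inv u = Superseries (\<lambda>n. cf0 u (- n)) (\<lambda>n. gconst \<i> * cf1 u (- n - 1))"

lemma cf_subst_inversion [simp]:
  "cf0 (subst_inversion u) n = cf0 u (- n)" "cf1 (subst_inversion u) n = gconst (- \<i>) * cf1 u (- n - 1)"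
  by (simp_all add: subst_inversion_def)

lemma subst_inversion_inverse [simp]:
  "subst_inversion (subst_inversion_inv u) = u" "subst_inversion_inv (subst_inversion u) = u"
  by (rule superseries_eqI; simp add: subst_inversion_inv_def flip: mult.assoc gconst_mult)+

text \<open>Conjugation takes L with index -n to minus L with index n, J with index -n to J with
  index n, and G with index -n + 1/2 to i times G with index n - 1/2. The signs and factors i in the
  exponent at infinity match this.\<close>

lemma subst_inversion_terms:
  "subst_inversion (terms_infinity A1 A2 M1 M2 n u) = terms_zero A1 A2 M1 M2 n (subst_inversion u)"
proof (rule superseries_eqI)
  fix k
  show "cf0 (subst_inversion (terms_infinity A1 A2 M1 M2 n u)) k = cf0 (terms_zero A1 A2 M1 M2 n (subst_inversion u)) k"
    by (rule grassmann_eqI)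
      (simp add: terms_infinity_def terms_zero_def Lop_def Jop_def Gop_def
        gcoeff_mult_scalars distrib_left distrib_right left_diff_distrib right_diff_distrib; simp add: algebra_simps power3_eq_cube)
  show "cf1 (subst_inversion (terms_infinity A1 A2 M1 M2 n u)) k = cf1 (terms_zero A1 A2 M1 M2 n (subst_inversion u)) k"
    by (rule grassmann_eqI)
      (simp add: terms_infinity_def terms_zero_def Lop_def Jop_def Gop_def
        gcoeff_mult_scalars distrib_left distrib_right left_diff_distrib right_diff_distrib; simp add: field_simps power3_eq_cube)
qed

lemma gconst_mult_eq_0_iff: "gconst c * a = 0 \<longleftrightarrow> c = 0 \<or> a = 0"
proof
  assume "gconst c * a = 0"
  then have "c * gcoeff a S = 0" for S by (metis gcoeff_gconst_mult gcoeff_zero)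
  then show "c = 0 \<or> a = 0" by (auto intro: grassmann_eqI)
qed auto

text \<open>The substitution permutes exponents by these two reflections, the first in the part
  without \<phi> and the second in the \<phi>-part, so conditions on all coefficients carry
  over.\<close>

lemma all_int_reflect:
  fixes P :: "int \<Rightarrow> bool"
  shows "(\<forall>n. P (- n)) \<longleftrightarrow> (\<forall>n. P n)" "(\<forall>n. P (- n - 1)) \<longleftrightarrow> (\<forall>n. P n)"
proof -
  show "(\<forall>n. P (- n)) \<longleftrightarrow> (\<forall>n. P n)" by (metis minus_minus)
  have "P n" if "\<forall>n. P (- n - 1)" for n
    using that[rule_format, of "- n - 1"] by simp
  then show "(\<forall>n. P (- n - 1)) \<longleftrightarrow> (\<forall>n. P n)" by blast
qed

lemma fsummable_subst_inversion:
  "fsummable I (\<lambda>i. subst_inversion (u i)) \<longleftrightarrow> fsummable I u"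
proof -
  from all_int_reflect(1)[of "\<lambda>n. finite {i \<in> I. cf0 (u i) n \<noteq> 0}"]
    all_int_reflect(2)[of "\<lambda>n. finite {i \<in> I. cf1 (u i) n \<noteq> 0}"]
  show ?thesis unfolding fsummable_def all_conj_distrib by (simp add: gconst_mult_eq_0_iff)
qed

lemma fsum_subst_inversion: "subst_inversion (fsum I u) = fsum I (\<lambda>i. subst_inversion (u i))"
  by (rule superseries_eqI) (simp_all add: fsum_def gconst_mult_eq_0_iff sum_distrib_left)

lemma subst_inversion_cmul: "subst_inversion (c *\<^sub>\<complex> u) = c *\<^sub>\<complex> subst_inversion u"
  by (rule superseries_eqI; rule grassmann_eqI; simp)

text \<open>The substitution permutes coefficients up to nonzero scalars. It therefore respects
  formal sums and their existence, and transports the whole exponential.\<close>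

lemma
  shows exp_sum_exists_terms_infinity: "exp_sum_exists (terms_infinity A1 A2 M1 M2) u \<longleftrightarrow>
      exp_sum_exists (terms_zero A1 A2 M1 M2) (subst_inversion u)"
    and exp_sum_terms_infinity: "subst_inversion (exp_sum (terms_infinity A1 A2 M1 M2) u) =
      exp_sum (terms_zero A1 A2 M1 M2) (subst_inversion u)"
proof -
  define T where "T = (\<lambda>w. fsum {1..} (\<lambda>n. terms_zero A1 A2 M1 M2 n w))"
  define T' where "T' = (\<lambda>w. fsum {1..} (\<lambda>n. terms_infinity A1 A2 M1 M2 n w))"
  have "subst_inversion (T' w) = T (subst_inversion w)" for w
    by (simp add: T_def T'_def fsum_subst_inversion subst_inversion_terms)
  then have T: "(T ^^ k) (subst_inversion u) = subst_inversion ((T' ^^ k) u)" for k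
    by (induction k) simp_all
  show "exp_sum_exists (terms_infinity A1 A2 M1 M2) u \<longleftrightarrow>
      exp_sum_exists (terms_zero A1 A2 M1 M2) (subst_inversion u)"
    unfolding exp_sum_exists_def Let_def T_def[symmetric] T'_def[symmetric] T
    by (simp only: flip: subst_inversion_terms subst_inversion_cmul)
      (simp only: fsummable_subst_inversion)
  show "subst_inversion (exp_sum (terms_infinity A1 A2 M1 M2) u) =
      exp_sum (terms_zero A1 A2 M1 M2) (subst_inversion u)"
    unfolding exp_sum_def exp_op_def T_def[symmetric] T'_def[symmetric] T
    by (simp only: fsum_subst_inversion subst_inversion_cmul)
qed

text \<open>The substitution sends 1/x to x and i\<phi>/x to \<phi>. The exponent -1 of x inverts
  the rescaling, which turns \<open>pow_2L0\<close> into \<open>pow_minus_2L0\<close>; the factor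
  from J is unaffected.\<close>

lemma subst_inversion_base:
  assumes "a \<in> carrier (unit_pairs L)"
  shows "map_prod subst_inversion subst_inversion (base_infinity L a) = base_zero L a"
proof -
  obtain a1 a2 where a: "a = (a1, a2)" and U: "a1 \<in> Units (even_monoid L)" "a2 \<in> Units (even_monoid L)"
    using assms by auto
  interpret group "even_units L" by (rule group_even_units)
  let ?i = "\<lambda>x. inv\<^bsub>even_units L\<^esub> x"
  have "?i a1 * ?i a1 \<in> carrier (even_units L)" using U Units_even_monoid_closed(3,4) by simp
  then have "(?i a1 * ?i a1) [^]\<^bsub>even_units L\<^esub> (-1 :: int) = ?i (?i a1 * ?i a1)"
    by (simp add: int_pow_neg)
  also have "\<dots> = a1 * a1"
  proof (rule inv_equality)
    have "a1 * a1 * (?i a1 * ?i a1) = a1 * (a1 * ?i a1) * ?i a1" by (simp add: mult.assoc)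
    then show "a1 * a1 \<otimes>\<^bsub>even_units L\<^esub> (?i a1 * ?i a1) = \<one>\<^bsub>even_units L\<^esub>"
      using U by (simp add: inv_even_units)
  qed (use U in \<open>simp_all add: Units_even_monoid_closed\<close>)
  finally have p: "(?i a1 * ?i a1) [^]\<^bsub>even_units L\<^esub> (-1 :: int) = a1 * a1" .
  have q: "1 [^]\<^bsub>even_units L\<^esub> (n :: int) = 1" for n
    using int_pow_one[of n] by simp
  have r: "a1 * (a1 * (?i a1 * x)) = a1 * x" for x
    using U by (metis inv_even_units(1) mult.assoc mult_1_right)
  have s: "gconst (- \<i>) * (a1 * (?i a2 * gconst \<i>)) = a1 * ?i a2"
    by (rule grassmann_eqI) (simp add: gcoeff_mult_scalars flip: mult.assoc)
  show ?thesis
    unfolding a base_zero_eq[OF U] base_infinity_def Let_def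
    by (auto simp: pow_2L0_def pow_minus_2L0_def pow_minus_J0_def rescale_def ss_one_def var_phi_def single_def p q r s
        mult.assoc nat_eq_iff xpow_def cmul_def smul_def intro!: superseries_eqI)
qed

lemma Grass_part_gconst_mult_iff:
  assumes "c \<noteq> 0"
  shows "gconst c * a \<in> Grass_part L p \<longleftrightarrow> a \<in> Grass_part L p"
proof
  assume "gconst c * a \<in> Grass_part L p"
  then have "gconst (1 / c) * (gconst c * a) \<in> Grass_part L p" by (rule Grass_part_gconst_mult)
  with assms show "a \<in> Grass_part L p" by (simp flip: mult.assoc gconst_mult)
qed simp

lemma subst_inversion_series_in:
  "subst_inversion u \<in> series_in I (Grass_part L p) J (Grass_part L q) \<longleftrightarrow>
     u \<in> series_in (uminus ` I) (Grass_part L p) ((\<lambda>n. - n - 1) ` J) (Grass_part L q)"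
proof -
  have "n \<in> uminus ` I \<longleftrightarrow> - n \<in> I" "n \<in> (\<lambda>n. - n - 1) ` J \<longleftrightarrow> - n - 1 \<in> J" for n
    by (force simp: image_iff intro: bexI[of _ "- n"], force simp: image_iff intro: bexI[of _ "- n - 1"])
  then show ?thesis
    unfolding series_in_def
    using all_int_reflect(1)[of "\<lambda>n. cf0 u n \<in> Grass_part L p"] all_int_reflect(2)[of "\<lambda>n. cf1 u n \<in> Grass_part L q"]
      all_int_reflect(1)[of "\<lambda>n. - n \<notin> I \<longrightarrow> cf0 u n = 0"] all_int_reflect(2)[of "\<lambda>n. - n - 1 \<notin> J \<longrightarrow> cf1 u n = 0"]
    by (simp add: gconst_mult_eq_0_iff Grass_part_gconst_mult_iff)
qed

text \<open>The ranges at infinity are the images of those at zero under n to -n for x^n and n to -n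
  - 1 for \<phi> x^n.\<close>

lemma functions_infinity_iff:
  "f \<in> functions_infinity L \<longleftrightarrow> map_prod subst_inversion subst_inversion f \<in> functions_zero L"
proof -
  have UNIV: "range uminus = (UNIV :: int set)" "range (\<lambda>n. - n - 1) = (UNIV :: int set)"
    by (metis surj_def minus_minus, auto intro!: image_eqI[where x = "- _ - 1"])
  have I: "uminus ` {1..} = {..- 1 :: int}" "(\<lambda>n. - n - 1) ` {1..} = {..- 2 :: int}"
    "(\<lambda>n. - n - 1) ` {0..} = {..- 1 :: int}"
    by (auto intro!: image_eqI[where x = "- _ - 1"])
  show ?thesis
    unfolding functions_zero_def functions_infinity_def superanalytic_def SSeries_part_def
      invertible_infinity_def
    by (simp add: mem_Times_iff subst_inversion_series_in UNIV I)
qed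

definition expansion_infinity ::
  "enat \<Rightarrow> (grassmann \<times> grassmann) set \<times> gseq \<times> gseq \<times> gseq \<times> gseq \<Rightarrow> superseries \<times> superseries" where
  "expansion_infinity L = map_prod subst_inversion_inv subst_inversion_inv \<circ> expansion_zero L"

lemma bij_betw_expansion_infinity: "bij_betw (expansion_infinity L) (parameters L) (functions_infinity L)"
proof -
  have "bij_betw (map_prod subst_inversion_inv subst_inversion_inv) (functions_zero L) (functions_infinity L)"
    by (rule bij_betwI[where g = "map_prod subst_inversion subst_inversion"])
      (auto simp: functions_infinity_iff)
  with bij_betw_expansion_zero show ?thesis
    unfolding expansion_infinity_def by (rule bij_betw_trans)
qed

text \<open>Existence and value are read off at zero after the substitution, whose left inverse
  brings the value back.\<close>

lemma expansion_infinity_eq: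
  assumes "a \<in> carrier (unit_pairs L)" "(A1, A2, M1, M2) \<in> param_seqs L"
  shows "expression_infinity_exists L a A1 A2 M1 M2"
    and "expansion_infinity L (sign_subgroup L #>\<^bsub>unit_pairs L\<^esub> a, A1, A2, M1, M2) = expression_infinity L a A1 A2 M1 M2"
proof -
  let ?S = "map_prod subst_inversion subst_inversion"
  obtain u v where b: "base_infinity L a = (u, v)" by (cases "base_infinity L a")
  with subst_inversion_base[OF assms(1)]
  have z: "base_zero L a = (subst_inversion u, subst_inversion v)" by simp
  show "expression_infinity_exists L a A1 A2 M1 M2"
    using expression_zero_eq(1)[OF assms]
    by (simp add: expression_infinity_exists_def expression_zero_exists_def b z exp_sum_exists_terms_infinity)
  have "?S (expression_infinity L a A1 A2 M1 M2) = expression_zero L a A1 A2 M1 M2"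
    by (simp add: expression_infinity_def expression_zero_def b z Let_def exp_sum_terms_infinity)
  then show "expansion_infinity L (sign_subgroup L #>\<^bsub>unit_pairs L\<^esub> a, A1, A2, M1, M2) = expression_infinity L a A1 A2 M1 M2"
    unfolding expansion_infinity_def comp_def expansion_zero_eq[OF assms]
    by (cases "expression_infinity L a A1 A2 M1 M2") (metis map_prod_simp subst_inversion_inverse(2))
qed

text \<open>The equation determines \<open>F\<close>, since every element of
  \<open>parameters L\<close> is a coset with four sequences. Holding for each representative
  \<open>a\<close>, it also contains the independence of the expression from that choice.\<close>

theorem proposition6p18:
  fixes L :: enat
  shows
    "(\<forall>n. superderivation L 0 (Lop n) \<and> superderivation L 0 (Jop n) \<and>
          superderivation L 1 (Gop 1 n) \<and> superderivation L 1 (Gop 2 n)) \<and>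
     NS2_representation L 0 Lop Jop Gop \<and>
     (\<exists>F. bij_betw F (parameters L) (functions_zero L) \<and>
        (\<forall>a \<in> carrier (unit_pairs L). \<forall>A1 \<in> even_seqs L. \<forall>A2 \<in> even_seqs L.
         \<forall>M1 \<in> odd_seqs L. \<forall>M2 \<in> odd_seqs L.
           expression_zero_exists L a A1 A2 M1 M2 \<and>
           F (sign_subgroup L #>\<^bsub>unit_pairs L\<^esub> a, A1, A2, M1, M2)
             = expression_zero L a A1 A2 M1 M2)) \<and>
     (\<exists>F. bij_betw F (parameters L) (functions_infinity L) \<and>
        (\<forall>a \<in> carrier (unit_pairs L). \<forall>A1 \<in> even_seqs L. \<forall>A2 \<in> even_seqs L.
         \<forall>M1 \<in> odd_seqs L. \<forall>M2 \<in> odd_seqs L.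
           expression_infinity_exists L a A1 A2 M1 M2 \<and>
           F (sign_subgroup L #>\<^bsub>unit_pairs L\<^esub> a, A1, A2, M1, M2)
             = expression_infinity L a A1 A2 M1 M2))"
proof (intro conjI allI)
  show "superderivation L 0 (Lop n)" "superderivation L 0 (Jop n)"
    "superderivation L 1 (Gop 1 n)" "superderivation L 1 (Gop 2 n)" for n
    by (rule superderivation_Lop superderivation_Jop superderivation_Gop)+
  show "NS2_representation L 0 Lop Jop Gop" by (rule NS2_representation_ops)
  show "\<exists>F. bij_betw F (parameters L) (functions_zero L) \<and>
        (\<forall>a \<in> carrier (unit_pairs L). \<forall>A1 \<in> even_seqs L. \<forall>A2 \<in> even_seqs L.
         \<forall>M1 \<in> odd_seqs L. \<forall>M2 \<in> odd_seqs L.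
           expression_zero_exists L a A1 A2 M1 M2 \<and>
           F (sign_subgroup L #>\<^bsub>unit_pairs L\<^esub> a, A1, A2, M1, M2)
             = expression_zero L a A1 A2 M1 M2)"
    by (intro exI[of _ "expansion_zero L"] conjI bij_betw_expansion_zero ballI
        expression_zero_eq(1) expansion_zero_eq) (simp_all add: param_seqs_def)
  show "\<exists>F. bij_betw F (parameters L) (functions_infinity L) \<and>
        (\<forall>a \<in> carrier (unit_pairs L). \<forall>A1 \<in> even_seqs L. \<forall>A2 \<in> even_seqs L.
         \<forall>M1 \<in> odd_seqs L. \<forall>M2 \<in> odd_seqs L.
           expression_infinity_exists L a A1 A2 M1 M2 \<and>
           F (sign_subgroup L #>\<^bsub>unit_pairs L\<^esub> a, A1, A2, M1, M2)
             = expression_infinity L a A1 A2 M1 M2)"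
    by (intro exI[of _ "expansion_infinity L"] conjI bij_betw_expansion_infinity ballI
        expansion_infinity_eq) (simp_all add: param_seqs_def)
qed

end
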